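(* Consider, in $\mathbb{R}^N$, the equation $$-\Delta u=|u|^{p-1}u+M|\nabla u|^q . \qquad(\ast)$$ 1. Let $N\ge1$, $p>1$ and $q>\frac{2p}{p+1}$. Then there exists no radial ground state $u$ of $(\ast)$ satisfying $u(0)=1$ when $M>0$ is too large; that is, there is $M_1>0$ (depending on $N,p,q$) such that none exists for $M>M_1$. 2. Let $1<p<\frac{N+2}{N-2}$ (any $p>1$ if $N=1,2$). If $1<q\le p$, there exists no radial ground state of $(\ast)$ for any $M>0$. If $q>p$, there exists no radial ground state $u$ of $(\ast)$ satisfying $u(0)=1$ for $M>0$ small enough; that is, there is $M_2>0$ (depending on $N,p,q$) such that none exists for $0<M<M_2$. 3. Let $N\ge 3$, $p>\frac{N+2}{N-2}$ and $q\ge\frac{2p}{p+1}$. Then there exist radial ground states of $(\ast)$ for $M>0$ small enough; that is, there is $M_3>0$ (depending on $N,p,q$) such that a radial ground state exists for every $0<M<M_3$.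
   Context: A ground state is a positive (classical, $C^2$) solution of $(\ast)$ in the whole space $\mathbb{R}^N$; it is called radial if it is radial with respect to $0$. A radial solution $u=u(r)$, $r=|x|$, satisfies $-u''-\frac{N-1}{r}u'=|u|^{p-1}u+M|u'|^q$ on $(0,\infty)$, with $u'(0)=0$. *)

theory Defs
  imports "HOL-Analysis.Analysis"
begin

definition partial_deriv :: "'a \<Rightarrow> ('a::euclidean_space \<Rightarrow> real) \<Rightarrow> 'a \<Rightarrow> real" where
  "partial_deriv b u x = frechet_derivative u (at x) b"

definition gradient :: "('a::euclidean_space \<Rightarrow> real) \<Rightarrow> 'a \<Rightarrow> 'a" where
  "gradient u x = (\<Sum>b\<in>Basis. partial_deriv b u x *\<^sub>R b)"

definition laplacian :: "('a::euclidean_space \<Rightarrow> real) \<Rightarrow> 'a \<Rightarrow> real" where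
  "laplacian u x = (\<Sum>b\<in>Basis. partial_deriv b (partial_deriv b u) x)"

definition C1_fun :: "('a::euclidean_space \<Rightarrow> real) \<Rightarrow> bool" where
  "C1_fun u \<longleftrightarrow> (\<forall>x. u differentiable (at x)) \<and> (\<forall>b\<in>Basis. continuous_on UNIV (partial_deriv b u))"

definition C2_fun :: "('a::euclidean_space \<Rightarrow> real) \<Rightarrow> bool" where
  "C2_fun u \<longleftrightarrow> (\<forall>x. u differentiable (at x)) \<and> (\<forall>b\<in>Basis. C1_fun (partial_deriv b u))"

text \<open>
  \<^const>\<open>frechet_derivative\<close> is a choice operator, so \<^const>\<open>partial_deriv\<close>, \<^const>\<open>gradient\<close> and
  \<^const>\<open>laplacian\<close> are meaningful only where the derivatives exist; below they are applied to
  \<^const>\<open>C2_fun\<close> functions only. The gradient then agrees with the library's \<^const>\<open>gderiv\<close>.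
\<close>

lemma gradient_eq_if_gderiv:
  assumes "GDERIV u x :> D"
  shows "gradient u x = D"
proof -
  have "(u has_derivative (\<lambda>h. inner h D)) (at x)"
    using assms by (simp add: gderiv_def)
  then have "frechet_derivative u (at x) = (\<lambda>h. inner h D)"
    by (rule frechet_derivative_at[symmetric])
  then show ?thesis
    by (simp add: gradient_def partial_deriv_def inner_commute[of _ D] euclidean_representation)
qed

definition radial :: "('a::euclidean_space \<Rightarrow> real) \<Rightarrow> bool" where
  "radial u \<longleftrightarrow> (\<forall>x y. norm x = norm y \<longrightarrow> u x = u y)"

text \<open>
  Since \<open>0 powr a = 0\<close> for every exponent, the powers below have their usual meaning whenever
  \<open>p > 1\<close> and \<open>q > 0\<close>.
\<close>

definition classical_solution ::
    "real \<Rightarrow> real \<Rightarrow> real \<Rightarrow> ('a::euclidean_space \<Rightarrow> real) \<Rightarrow> bool" where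
  "classical_solution p q M u \<longleftrightarrow> C2_fun u \<and>
     (\<forall>x. - laplacian u x = \<bar>u x\<bar> powr (p - 1) * u x + M * norm (gradient u x) powr q)"

definition ground_state ::
    "real \<Rightarrow> real \<Rightarrow> real \<Rightarrow> ('a::euclidean_space \<Rightarrow> real) \<Rightarrow> bool" where
  "ground_state p q M u \<longleftrightarrow> classical_solution p q M u \<and> (\<forall>x. u x > 0)"

definition radial_ground_state ::
    "real \<Rightarrow> real \<Rightarrow> real \<Rightarrow> ('a::euclidean_space \<Rightarrow> real) \<Rightarrow> bool" where
  "radial_ground_state p q M u \<longleftrightarrow> ground_state p q M u \<and> radial u"

end

theory Submission
  imports Defs
begin

text \<open>
  Write \<open>N = d + 1\<close>. A radial solution is a pair \<open>(u, w)\<close> with \<open>u' = - w\<close> and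
  \<open>(r\<^sup>d w)' = r\<^sup>d (u\<^sup>p + M w\<^sup>q)\<close>. Once \<open>M w\<^sup>q\<^sup>-\<^sup>1 r \<ge> 2 N\<close> at some radius, the Riccati inequality
  \<open>w' \<ge> (M / 2) w\<^sup>q\<close> makes \<open>w\<close> blow up; for large \<open>M\<close> this happens at a radius of order
  \<open>M\<^sup>-\<^sup>1\<^sup>/\<^sup>q\<close>, before \<open>u\<close> has dropped below \<open>1/2\<close>. For subcritical \<open>p\<close> a first-order differential
  inequality shows that \<open>w / (r u\<^sup>m)\<close> with \<open>m = (p + 1) / 2\<close> is nondecreasing, so \<open>u\<close> decays faster
  than \<open>r\<^sup>2\<^sup>-\<^sup>N\<close>, which superharmonicity forbids. For supercritical \<open>p\<close> a Pohozaev function with a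
  slightly shifted multiplier stays nonpositive when \<open>M\<close> is small, which keeps \<open>u\<close> positive for all
  \<open>r\<close>; the solution itself comes from a contraction argument for a truncated equation.
\<close>

subsection \<open>Radial solutions and non-existence for large M\<close>

text \<open>Unless \<open>q = 2p/(p+1)\<close>, rescaling a solution changes \<open>M\<close>, so
  the size of \<open>M\<close> only has a meaning relative to a normalization such as
  \<open>u(0) = 1\<close>. The exponent \<open>2p/(p+1)\<close> is also the threshold from which
  \<open>r * w powr (q - 1)\<close> stays bounded under the universal decay
  \<open>u = O(r^(-2/(p-1)))\<close>, \<open>w = O(u/r)\<close>. This bound lets a small
  \<open>M\<close> be absorbed, both in the subcritical range with \<open>q > p\<close> and in the
  supercritical range; for subcritical \<open>p\<close> and \<open>q <= p\<close> the gradient term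
  already has a favourable sign. The exponent \<open>m\<close> comes from the critical bubbles: for
  \<open>M = 0\<close> and critical \<open>p\<close> they are the solutions with
  \<open>w / (r u^m)\<close> constant. The gradient term has no variational structure, so the
  function compared with them has to carry a fraction \<open>phi\<close> of it. The supercritical
  argument is circular at first sight: the bounds that make the Pohozaev function decrease are
  consequences of its being nonpositive. Working with strict inequalities that are required only at
  a contact point breaks the circle.\<close>

text \<open>At the last point of \<open>[a, b]\<close> where \<open>f \<ge> k\<close>, a later
  failure would force \<open>f = k\<close>, and the positive derivative pushes \<open>f\<close>
  above \<open>k\<close> again. The sign of \<open>f'\<close> is required only at contact, so
  estimates that are themselves consequences of \<open>f \<ge> k\<close> may be used to check
  it.\<close>

lemma barrier:
  fixes f f' :: "real \<Rightarrow> real"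
  assumes ab: "a \<le> b"
    and deriv: "\<And>r. a \<le> r \<Longrightarrow> r \<le> b \<Longrightarrow> (f has_real_derivative f' r) (at r)"
    and start: "k \<le> f a"
    and pos: "\<And>r. a \<le> r \<Longrightarrow> r \<le> b \<Longrightarrow> f r = k \<Longrightarrow> f' r > 0"
  shows "k \<le> f b"
proof (rule ccontr)
  assume neg: "\<not> k \<le> f b"
  have cont: "continuous_on {a..b} f"
    using deriv by (force intro!: continuous_at_imp_continuous_on DERIV_isCont)
  define S where "S = {a..b} \<inter> f -` {k..}"
  have "closed S"
    unfolding S_def by (intro continuous_closed_preimage cont) auto
  moreover have Sne: "a \<in> S" and "bdd_above S"
    using ab start by (auto simp: S_def intro!: bdd_aboveI[of _ b])
  ultimately have sS: "Sup S \<in> S"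
    using closed_contains_Sup by blast
  define s where "s = Sup S"
  have s: "a \<le> s" "s \<le> b" "f s \<ge> k"
    using sS by (auto simp: S_def s_def)
  then have "s < b"
    using neg by (cases "s = b") auto
  have after: "f x < k" if "s < x" "x \<le> b" for x
  proof (rule ccontr)
    assume "\<not> f x < k"
    then have "x \<in> S"
      using that s by (auto simp: S_def)
    then show False
      using that cSup_upper[OF _ \<open>bdd_above S\<close>] by (fastforce simp: s_def)
  qed
  have "f s = k"
  proof (rule ccontr)
    assume "f s \<noteq> k"
    then have "k < f s"
      using s by simp
    have "isCont f s"
      using deriv s DERIV_isCont by blast
    then have "eventually (\<lambda>x. k < f x) (at s)"
      using \<open>k < f s\<close> by (simp add: isCont_def order_tendstoD)
    then obtain e where e: "e > 0" "\<And>x. x \<noteq> s \<Longrightarrow> dist x s < e \<Longrightarrow> k < f x"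
      by (auto simp: eventually_at)
    define x where "x = s + min (e/2) (b - s)"
    have "s < x" "x \<le> b" "dist x s < e"
      using e \<open>s < b\<close> by (auto simp: x_def dist_real_def min_def)
    then show False
      using e(2)[of x] after[of x] by auto
  qed
  then have "f' s > 0"
    using pos s by auto
  then obtain e where e: "e > 0" "\<And>h. h > 0 \<Longrightarrow> h < e \<Longrightarrow> f s < f (s + h)"
    using DERIV_pos_inc_right[OF deriv] s by blast
  define h where "h = min (e/2) (b - s)"
  have "h > 0" "h < e" "s + h \<le> b"
    using e \<open>s < b\<close> by (auto simp: h_def min_def)
  then show False
    using e(2)[of h] after[of "s + h"] \<open>f s = k\<close> by auto
qed

lemma first_hit:
  fixes f :: "real \<Rightarrow> real"
  assumes "continuous_on {a..b} f" "a \<le> b" "f a < k" "k \<le> f b"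
  obtains s where "a < s" "s \<le> b" "f s = k" "\<And>x. a \<le> x \<Longrightarrow> x < s \<Longrightarrow> f x < k"
proof -
  define S where "S = {a..b} \<inter> f -` {k..}"
  have "closed S"
    unfolding S_def by (intro continuous_closed_preimage assms) auto
  moreover have "b \<in> S" and bdd: "bdd_below S"
    using assms by (auto simp: S_def intro!: bdd_belowI[of _ a])
  ultimately have "Inf S \<in> S"
    using closed_contains_Inf by blast
  define s where "s = Inf S"
  have s: "a \<le> s" "s \<le> b" "k \<le> f s"
    using \<open>Inf S \<in> S\<close> by (auto simp: S_def s_def)
  have before: "f x < k" if "a \<le> x" "x < s" for x
  proof (rule ccontr)
    assume "\<not> f x < k"
    then have "x \<in> S"
      using that s by (auto simp: S_def)
    then show False
      using that cInf_lower[OF _ bdd] by (fastforce simp: s_def)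
  qed
  obtain x where x: "a \<le> x" "x \<le> s" "f x = k"
    using IVT'[of f a k s] s assms continuous_on_subset[OF assms(1), of "{a..s}"] by force
  then have "f s = k"
    using before[of x] by (cases "x = s") auto
  moreover have "a < s"
    using s assms \<open>f s = k\<close> by (cases "a = s") auto
  ultimately show ?thesis
    using that s before by blast
qed

lemma has_real_derivative_powr_const:
  fixes g :: "real \<Rightarrow> real"
  assumes "(g has_real_derivative D) (at x)" "g x > 0"
  shows "((\<lambda>x. g x powr a) has_real_derivative a * g x powr (a - 1) * D) (at x)"
  using DERIV_fun_powr[OF assms, of a] by simp

text \<open>Here \<open>w = -u'\<close>. The equation for \<open>w\<close> is imposed only for
  \<open>r > 0\<close> because \<open>d / r\<close> is singular; \<open>w 0 = 0\<close> with
  continuity replaces it at the centre. The forcing \<open>f\<close> stays abstract so that the same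
  estimates serve the true equation and its truncation.\<close>

locale radial_ode =
  fixes d :: nat and u w f :: "real \<Rightarrow> real"
  assumes deriv_u: "\<And>r. (u has_real_derivative - w r) (at r)"
    and cont_w: "continuous_on UNIV w"
    and w_zero: "w 0 = 0"
    and deriv_w: "\<And>r. r > 0 \<Longrightarrow> (w has_real_derivative f r - real d / r * w r) (at r)"
begin

lemma cont_u: "continuous_on UNIV u"
  using deriv_u by (auto intro!: continuous_at_imp_continuous_on DERIV_isCont)

lemma deriv_flux:
  assumes "r > 0"
  shows "((\<lambda>r. r ^ d * w r) has_real_derivative r ^ d * f r) (at r)"
proof -
  have "real d * r ^ (d - 1) = r ^ d * (real d / r)"
    using assms by (cases d) auto
  then show ?thesis
    using deriv_w[OF assms]
    by (auto intro!: derivative_eq_intros simp: algebra_simps)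
qed

lemma cont_flux: "continuous_on S (\<lambda>r. r ^ d * w r)"
  by (intro continuous_intros continuous_on_subset[OF cont_w]) auto

lemma flux_mono:
  assumes "0 \<le> a" "a \<le> b" "\<And>s. a < s \<Longrightarrow> s < b \<Longrightarrow> f s \<ge> 0"
  shows "a ^ d * w a \<le> b ^ d * w b"
proof (rule DERIV_nonneg_imp_increasing_open[OF assms(2)])
  show "\<exists>y. ((\<lambda>r. r ^ d * w r) has_real_derivative y) (at x) \<and> 0 \<le> y" if "a < x" "x < b" for x
    using deriv_flux[of x] assms that by (intro exI[of _ "x ^ d * f x"]) auto
qed (rule cont_flux)

lemma w_pos:
  assumes "0 < r" "\<And>s. 0 < s \<Longrightarrow> s < r \<Longrightarrow> f s > 0"
  shows "w r > 0"
proof -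
  have "0 ^ d * w 0 < r ^ d * w r"
  proof (rule DERIV_pos_imp_increasing_open[OF assms(1)])
    show "\<exists>y. ((\<lambda>r. r ^ d * w r) has_real_derivative y) (at x) \<and> 0 < y" if "0 < x" "x < r" for x
      using deriv_flux[of x] assms that by (intro exI[of _ "x ^ d * f x"]) auto
  qed (rule cont_flux)
  then show ?thesis
    using assms(1) by (simp add: w_zero zero_less_mult_iff)
qed

text \<open>Integrating \<open>(r^d w)' \<ge> c r^d\<close> from 0, where the flux vanishes,
  produces the factor \<open>d + 1 = N\<close>. The case \<open>c = 0\<close> yields the sign of
  \<open>w\<close>.\<close>

lemma w_lower_bound:
  assumes "0 < r" "\<And>s. 0 < s \<Longrightarrow> s < r \<Longrightarrow> c \<le> f s"
  shows "c * r / (real d + 1) \<le> w r"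
proof -
  define g where "g s = s ^ d * w s - c * s ^ Suc d / (real d + 1)" for s
  have "g 0 \<le> g r"
  proof (rule DERIV_nonneg_imp_increasing_open[of 0 r g])
    show "\<exists>y. (g has_real_derivative y) (at s) \<and> 0 \<le> y" if "0 < s" "s < r" for s
    proof (intro exI conjI)
      have "((\<lambda>s. c * s ^ Suc d / (real d + 1)) has_real_derivative c * s ^ d) (at s)"
        by (rule DERIV_cong[OF DERIV_cdivide[OF DERIV_cmult[OF DERIV_pow]]])
          (simp add: field_simps)
      then show "(g has_real_derivative (s ^ d * f s - c * s ^ d)) (at s)"
        unfolding g_def using deriv_flux[OF that(1)] by (rule DERIV_diff[rotated])
      show "0 \<le> s ^ d * f s - c * s ^ d"
        using assms(2)[OF that] that by (simp add: mult.commute mult_left_mono)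
    qed
    show "continuous_on {0..r} g"
      unfolding g_def by (intro continuous_intros cont_flux) auto
  qed (use assms in auto)
  then have "c * r ^ Suc d / (real d + 1) \<le> r ^ d * w r"
    by (simp add: g_def w_zero)
  then have "r ^ d * (c * r / (real d + 1)) \<le> r ^ d * w r"
    by (simp add: algebra_simps)
  then show ?thesis
    using mult_le_cancel_left_pos[of "r ^ d"] zero_less_power[OF assms(1)] by blast
qed

text \<open>A bootstrap: as long as \<open>w < K\<close> the gradient term is at most 1, hence
  \<open>w' \<le> 2\<close> and \<open>w \<le> 2r\<close>. Reaching the value \<open>K\<close> would
  therefore take a radius of at least \<open>K / 2\<close>.\<close>

lemma early_bound:
  assumes "M \<ge> 0" "q > 0" "K > 0" "M * K powr q \<le> 1"
    and f_le: "\<And>s. 0 < s \<Longrightarrow> s \<le> K / 2 \<Longrightarrow> f s \<le> 1 + M * w s powr q"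
    and w_nonneg: "\<And>s. 0 < s \<Longrightarrow> s \<le> K / 2 \<Longrightarrow> w s \<ge> 0"
    and r: "0 \<le> r" "r \<le> K / 2"
  shows "w r \<le> 2 * r"
proof -
  have key: "w b \<le> 2 * b" if b: "0 \<le> b" "b \<le> r" and le: "\<And>x. 0 \<le> x \<Longrightarrow> x < b \<Longrightarrow> w x < K" for b
  proof -
    have "2 * 0 - w 0 \<le> 2 * b - w b"
    proof (rule DERIV_nonneg_imp_increasing_open[OF b(1)])
      fix x assume x: "0 < x" "x < b"
      have "w x powr q \<le> K powr q"
        using le[of x] x w_nonneg[of x] b r assms by (intro powr_mono2) auto
      then have "M * w x powr q \<le> 1"
        using assms by (meson mult_left_mono order_trans)
      then have "f x \<le> 2"
        using f_le[of x] x b r by auto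
      moreover have "real d / x * w x \<ge> 0"
        using w_nonneg[of x] x b r by auto
      ultimately have "0 \<le> 2 - (f x - real d / x * w x)"
        by simp
      moreover have "((\<lambda>s. 2 * s - w s) has_real_derivative 2 - (f x - real d / x * w x)) (at x)"
        using deriv_w[OF x(1)] by (auto intro!: derivative_eq_intros)
      ultimately show "\<exists>y. ((\<lambda>s. 2 * s - w s) has_real_derivative y) (at x) \<and> 0 \<le> y"
        by blast
    qed (intro continuous_intros continuous_on_subset[OF cont_w]; simp)
    then show ?thesis
      by (simp add: w_zero)
  qed
  show ?thesis
  proof (rule ccontr)
    assume "\<not> w r \<le> 2 * r"
    then obtain x where x: "0 \<le> x" "x < r" "K \<le> w x"
      using key[of r] r by (meson not_less order_refl)
    obtain s where s: "0 < s" "s \<le> x" "w s = K" "\<And>x. 0 \<le> x \<Longrightarrow> x < s \<Longrightarrow> w x < K"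
      using first_hit[of 0 x w K] x w_zero assms continuous_on_subset[OF cont_w] by auto
    then have "K \<le> 2 * s"
      using key[of s] x by auto
    then show False
      using s x r by auto
  qed
qed

lemma u_antimono:
  assumes "0 \<le> a" "a \<le> b" "\<And>s. 0 < s \<Longrightarrow> s < b \<Longrightarrow> f s \<ge> 0"
  shows "u b \<le> u a"
proof (rule DERIV_nonpos_imp_decreasing_open[OF assms(2)])
  fix x assume x: "a < x" "x < b"
  have "0 * x / (real d + 1) \<le> w x"
    by (rule w_lower_bound) (use assms x in auto)
  then show "\<exists>y. (u has_real_derivative y) (at x) \<and> y \<le> 0"
    using deriv_u[of x] by (intro exI[of _ "- w x"]) auto
qed (rule continuous_on_subset[OF cont_u], simp)

text \<open>Since \<open>u\<close> decreases, \<open>w_lower_bound\<close> with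
  \<open>c = u(s)^p\<close> gives \<open>w \<ge> u^p s / N\<close>, so \<open>u^(1-p)\<close> has
  derivative at least \<open>(p - 1) s / N\<close>. The resulting decay
  \<open>u = O(r^(-2/(p-1)))\<close> has a constant independent of \<open>M\<close> and of
  \<open>u 0\<close>.\<close>

lemma decay:
  assumes p: "p > 1" and r: "0 \<le> r"
    and u_pos: "\<And>s. 0 \<le> s \<Longrightarrow> s \<le> r \<Longrightarrow> u s > 0"
    and f_ge: "\<And>s. 0 < s \<Longrightarrow> s < r \<Longrightarrow> u s powr p \<le> f s"
  shows "(p - 1) / (2 * (real d + 1)) * r\<^sup>2 \<le> u r powr (1 - p)"
proof -
  define c where "c = (p - 1) / (2 * (real d + 1))"
  define g where "g s = u s powr (1 - p) - c * s\<^sup>2" for s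
  have f0: "f s \<ge> 0" if "0 < s" "s < r" for s
    using f_ge[OF that] powr_ge_zero[of "u s" p] by linarith
  have "g 0 \<le> g r"
  proof (rule DERIV_nonneg_imp_increasing_open[OF r])
    fix s assume s: "0 < s" "s < r"
    have us: "u s > 0"
      using u_pos s by simp
    have "u s powr p * s / (real d + 1) \<le> w s"
    proof (rule w_lower_bound[OF s(1)])
      fix t assume t: "0 < t" "t < s"
      have "u s \<le> u t"
        using t s f0 by (intro u_antimono) auto
      then have "u s powr p \<le> u t powr p"
        using us p by (intro powr_mono2) auto
      then show "u s powr p \<le> f t"
        using f_ge[of t] t s by auto
    qed
    then have "u s powr (-p) * (u s powr p * s / (real d + 1)) \<le> u s powr (-p) * w s"
      by (intro mult_left_mono) auto
    moreover have "u s powr (-p) * (u s powr p * s / (real d + 1)) = s / (real d + 1)"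
      using us by (simp add: powr_minus field_simps)
    ultimately have "s / (real d + 1) \<le> u s powr (-p) * w s"
      by argo
    then have "(p - 1) * (s / (real d + 1)) \<le> (p - 1) * (u s powr (-p) * w s)"
      using p by (intro mult_left_mono) auto
    moreover have "((\<lambda>s. c * s\<^sup>2) has_real_derivative 2 * c * s) (at s)"
      by (auto intro!: derivative_eq_intros)
    then have "(g has_real_derivative (1 - p) * u s powr (1 - p - 1) * - w s - 2 * c * s) (at s)"
      unfolding g_def by (intro DERIV_diff has_real_derivative_powr_const deriv_u us)
    moreover have "(1 - p) * u s powr (1 - p - 1) * - w s - 2 * c * s =
        (p - 1) * (u s powr (-p) * w s) - (p - 1) * (s / (real d + 1))"
      by (simp add: c_def divide_simps) (simp add: algebra_simps)
    ultimately show "\<exists>y. (g has_real_derivative y) (at s) \<and> 0 \<le> y"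
      by (metis diff_ge_0_iff_ge)
  next
    show "continuous_on {0..r} g"
      unfolding g_def
      by (intro continuous_intros continuous_on_subset[OF cont_u]) (use u_pos in force)+
  qed
  then have "u 0 powr (1 - p) \<le> u r powr (1 - p) - c * r\<^sup>2"
    by (simp add: g_def)
  then have "c * r\<^sup>2 \<le> u r powr (1 - p)"
    using powr_ge_zero[of "u 0" "1 - p"] by linarith
  then show ?thesis
    by (simp add: c_def)
qed

end

text \<open>Negative radii only serve to make the derivative of \<open>u\<close> at 0 two-sided. A
  profile obtained from a ground state extends evenly, while the constructed one has
  \<open>w = 0\<close> and \<open>u = 1\<close> there.\<close>

locale radial_profile = radial_ode d u w "\<lambda>r. u r powr p + M * w r powr q"
  for d :: nat and u w :: "real \<Rightarrow> real" and p q M :: real +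
  assumes p_gt_1: "p > 1" and q_gt_1: "q > 1" and M_pos: "M > 0"
    and u_pos: "\<And>r. r \<ge> 0 \<Longrightarrow> u r > 0"
begin

lemma forcing_pos: "r \<ge> 0 \<Longrightarrow> 0 < u r powr p + M * w r powr q"
  using u_pos[of r] M_pos by (intro add_pos_nonneg) auto

lemma w_positive: "r > 0 \<Longrightarrow> w r > 0"
  using w_pos forcing_pos by auto

lemma w_nonneg: "r \<ge> 0 \<Longrightarrow> w r \<ge> 0"
  using w_positive[of r] w_zero by (cases "r = 0") auto

lemma u_decreasing: "0 \<le> a \<Longrightarrow> a \<le> b \<Longrightarrow> u b \<le> u a"
  using u_antimono[of a b] forcing_pos by (auto intro: less_imp_le)

text \<open>The factor 2 reserves half of \<open>M w^q\<close> to dominate \<open>d / r * w\<close>;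
  the other half drives the blow-up. A profile lives on the whole half-line, so the threshold can be
  reached at no radius.\<close>

lemma riccati_bound:
  assumes r0: "r0 > 0"
  shows "M * w r0 powr (q - 1) * r0 < 2 * (real d + 1)"
proof (rule ccontr)
  assume "\<not> ?thesis"
  then have big: "M * w r0 powr (q - 1) \<ge> 2 * (real d + 1) / r0"
    using r0 by (simp add: field_simps)
  define k where "k = w r0"
  have k: "k > 0"
    using w_positive r0 by (simp add: k_def)
  have riccati: "real d / r * w r \<le> M / 2 * w r powr q" if "r \<ge> r0" "w r \<ge> k" for r
  proof -
    have "real d / r \<le> (real d + 1) / r0"
      using that r0 by (intro frac_le) auto
    also have "\<dots> \<le> M / 2 * k powr (q - 1)"
      using big by (simp add: k_def field_simps)
    also have "\<dots> \<le> M / 2 * w r powr (q - 1)"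
      using that k q_gt_1 M_pos by (intro mult_left_mono powr_mono2) auto
    finally have "real d / r * w r \<le> M / 2 * w r powr (q - 1) * w r"
      using that k by (intro mult_right_mono) auto
    also have "\<dots> = M / 2 * w r powr q"
      using that k by (simp add: powr_diff)
    finally show ?thesis .
  qed
  \<comment> \<open>\<open>riccati\<close> presupposes \<open>w r \<ge> k\<close>, the very claim;
    \<open>barrier\<close> asks for it only where \<open>w = k\<close>.\<close>
  have ge: "w r \<ge> k" if r: "r \<ge> r0" for r
  proof (rule barrier[OF r])
    fix s assume s: "r0 \<le> s" "s \<le> r"
    show "(w has_real_derivative u s powr p + M * w s powr q - real d / s * w s) (at s)"
      using deriv_w s r0 by auto
    show "0 < u s powr p + M * w s powr q - real d / s * w s" if "w s = k"
    proof -
      have "M / 2 * w s powr q \<ge> 0"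
        using M_pos by simp
      moreover have "u s powr p > 0"
        using u_pos[of s] s r0 by simp
      ultimately show ?thesis
        using riccati[of s] s that by linarith
    qed
  qed (simp add: k_def)
  \<comment> \<open>Integrated form of \<open>w' \<ge> (M/2) w^q\<close>: \<open>G\<close> is
    nonincreasing although its second summand grows linearly, so \<open>w powr (1 - q)\<close> would
    have to become negative.\<close>
  define G where "G r = w r powr (1 - q) + (q - 1) * M / 2 * r" for r
  have G_le: "G r \<le> G r0" if r: "r0 \<le> r" for r
  proof (rule DERIV_nonpos_imp_nonincreasing[OF r])
    fix s assume s: "r0 \<le> s" "s \<le> r"
    have ws: "w s > 0"
      using w_positive s r0 by auto
    define w' where "w' = u s powr p + M * w s powr q - real d / s * w s"
    have w': "M / 2 * w s powr q \<le> w'"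
      using riccati[of s] ge[of s] s powr_ge_zero[of "u s" p] unfolding w'_def by linarith
    have "(w has_real_derivative w') (at s)"
      using deriv_w s r0 by (auto simp: w'_def)
    moreover have "((\<lambda>r. (q - 1) * M / 2 * r) has_real_derivative (q - 1) * M / 2) (at s)"
      by (auto intro!: derivative_eq_intros)
    ultimately have "(G has_real_derivative (1 - q) * w s powr (1 - q - 1) * w' + (q - 1) * M / 2) (at s)"
      unfolding G_def by (intro DERIV_add has_real_derivative_powr_const ws)
    moreover have "(1 - q) * w s powr (1 - q - 1) * w' + (q - 1) * M / 2 \<le> 0"
    proof -
      have "w s powr (-q) * (M / 2 * w s powr q) \<le> w s powr (-q) * w'"
        using w' by (intro mult_left_mono) auto
      then have "M / 2 \<le> w s powr (-q) * w'"
        using ws by (simp add: powr_minus field_simps)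
      then have "(q - 1) * (M / 2) \<le> (q - 1) * (w s powr (-q) * w')"
        using q_gt_1 by (intro mult_left_mono) auto
      then show ?thesis
        by (simp add: algebra_simps)
    qed
    ultimately show "\<exists>y. (G has_real_derivative y) (at s) \<and> y \<le> 0"
      by blast
  qed
  define c where "c = (q - 1) * M / 2"
  have c: "c > 0"
    using q_gt_1 M_pos by (simp add: c_def)
  define r where "r = max r0 (G r0 / c + 1)"
  have "G r = w r powr (1 - q) + c * r"
    by (simp add: G_def c_def)
  moreover have "G r \<le> G r0"
    by (rule G_le) (simp add: r_def)
  ultimately have "c * r \<le> G r0"
    using powr_ge_zero[of "w r" "1 - q"] by linarith
  moreover have "c * r \<ge> c * (G r0 / c + 1)"
    using c by (intro mult_left_mono) (auto simp: r_def)
  moreover have "c * (G r0 / c + 1) = G r0 + c"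
    using c by (simp add: distrib_left)
  ultimately show False
    using c by linarith
qed

lemma w_early:
  assumes "u 0 = 1" "0 \<le> r" "r \<le> M powr (-1/q) / 2"
  shows "w r \<le> 2 * r"
proof (rule early_bound[where M = M and q = q and K = "M powr (-1/q)"])
  show "M * (M powr (-1/q)) powr q \<le> 1"
    using M_pos q_gt_1 by (simp add: powr_powr powr_neg_one)
  fix s :: real assume s: "0 < s"
  have "u s powr p \<le> 1 powr p"
    using u_decreasing[of 0 s] assms s u_pos[of s] p_gt_1 by (intro powr_mono2) auto
  then show "u s powr p + M * w s powr q \<le> 1 + M * w s powr q"
    by simp
qed (use assms M_pos q_gt_1 w_nonneg in auto)

end

context radial_profile
begin

text \<open>Between \<open>r\<close> and \<open>2r\<close> the positive function \<open>u\<close>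
  cannot lose more than \<open>u r\<close>. The loss is \<open>r * w x\<close> at a mean value point
  \<open>x\<close>, and monotonicity of the flux compares \<open>w x\<close> with \<open>w r\<close>
  up to \<open>(x / r)^d \<le> 2^d\<close>.\<close>

lemma rw_le_u:
  assumes r: "r > 0"
  shows "r * w r \<le> 2 ^ d * u r"
proof -
  obtain x where x: "r < x" "x < 2 * r" "u (2 * r) - u r = (2 * r - r) * - w x"
    using MVT2[of r "2 * r" u "\<lambda>x. - w x"] r deriv_u by auto
  have "r ^ d * w r \<le> x ^ d * w x"
    using x r forcing_pos by (intro flux_mono) (auto intro: less_imp_le)
  also have "\<dots> \<le> (2 * r) ^ d * w x"
    using x r w_positive[of x] by (intro mult_right_mono power_mono) auto
  finally have "r ^ d * w r \<le> r ^ d * (2 ^ d * w x)"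
    by (simp add: power_mult_distrib mult_ac)
  then have "w r \<le> 2 ^ d * w x"
    using mult_le_cancel_left_pos[of "r ^ d"] zero_less_power[OF r] by blast
  then have "r * w r \<le> r * (2 ^ d * w x)"
    using r by (intro mult_left_mono) auto
  also have "\<dots> = 2 ^ d * (u r - u (2 * r))"
  proof -
    have "r * w x = u r - u (2 * r)"
      using x(3) by simp
    then show ?thesis
      by (metis mult.left_commute)
  qed
  also have "\<dots> \<le> 2 ^ d * u r"
    using u_pos[of "2 * r"] r by (intro mult_left_mono) auto
  finally show ?thesis .
qed

lemma u_decay:
  assumes "r \<ge> 0"
  shows "(p - 1) / (2 * (real d + 1)) * r\<^sup>2 \<le> u r powr (1 - p)"
  using assms M_pos by (intro decay) (auto simp: p_gt_1 u_pos)

end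

text \<open>Multiplication by \<open>exp (- A)\<close>, with \<open>A\<close> a primitive of
  \<open>a\<close>, turns \<open>D' = a D + b\<close> into a monotonicity statement;
  \<open>a\<close> may have any sign. Derivatives are taken only in the open interval since profiles
  are singular at 0.\<close>

lemma linear_differential_inequality:
  fixes D a b :: "real \<Rightarrow> real"
  assumes R: "0 \<le> R" and a: "continuous_on {0..R} a" and D: "continuous_on {0..R} D"
    and D0: "D 0 \<ge> 0"
    and deriv: "\<And>s. 0 < s \<Longrightarrow> s < R \<Longrightarrow> (D has_real_derivative D s * a s + b s) (at s)"
    and b: "\<And>s. 0 < s \<Longrightarrow> s < R \<Longrightarrow> b s \<ge> 0"
  shows "D R \<ge> 0"
proof -
  obtain A where A: "\<And>x. x \<in> {0..R} \<Longrightarrow> (A has_vector_derivative a x) (at x within {0..R})"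
    using antiderivative_continuous[OF a] by blast
  have cont_A: "continuous_on {0..R} A"
    by (rule continuous_on_vector_derivative[OF A])
  have "D 0 * exp (- A 0) \<le> D R * exp (- A R)"
  proof (rule DERIV_nonneg_imp_increasing_open[OF R])
    fix s assume s: "0 < s" "s < R"
    have "(A has_real_derivative a s) (at s)"
      using A[of s] s at_within_Icc_at[of 0 s R]
      by (simp add: has_real_derivative_iff_has_vector_derivative)
    then have "((\<lambda>s. exp (- A s)) has_real_derivative exp (- A s) * - a s) (at s)"
      by (intro DERIV_fun_exp DERIV_minus)
    then have "((\<lambda>s. D s * exp (- A s)) has_real_derivative
        (D s * a s + b s) * exp (- A s) + exp (- A s) * - a s * D s) (at s)"
      by (intro DERIV_mult deriv s)
    also have "(D s * a s + b s) * exp (- A s) + exp (- A s) * - a s * D s = b s * exp (- A s)"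
      by (simp add: algebra_simps)
    finally have "((\<lambda>s. D s * exp (- A s)) has_real_derivative b s * exp (- A s)) (at s)" .
    then show "\<exists>y. ((\<lambda>s. D s * exp (- A s)) has_real_derivative y) (at s) \<and> 0 \<le> y"
      using b[OF s] by (intro exI[of _ "b s * exp (- A s)"]) auto
  next
    show "continuous_on {0..R} (\<lambda>s. D s * exp (- A s))"
      by (intro continuous_intros D cont_A)
  qed
  moreover have "0 \<le> D 0 * exp (- A 0)"
    using D0 by simp
  ultimately have "0 \<le> D R * exp (- A R)"
    by linarith
  then show ?thesis
    by (simp add: zero_le_mult_iff)
qed

text \<open>Read \<open>y = w/u\<close>, \<open>z = w^(q-1)\<close>, \<open>P = u^p\<close>,
  \<open>v = r w'\<close>. The left side is \<open>r^(-d)\<close> times the derivative of the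
  comparison function \<open>D\<close> of \<open>bubble_comparison\<close>; the right side is
  \<open>r^(-d) D\<close> times a factor, plus a remainder. The two sides differ by
  \<open>M z w (phi (N + q) - N)\<close>, which dictates \<open>phi\<close>.\<close>

lemma subcritical_identity:
  fixes r w y z P M N m q phi v :: real
  assumes phi: "phi * (N + q) = N" and v: "v = r * P + r * M * z * w - (N - 1) * w"
  shows "N * (P + phi * M * (z * w) + m * (w * y))
           + (- r * (2 * m - 1) * P * y + phi * M * (q * z * v) + m * (2 * y * v + r * w * y\<^sup>2))
           - N * (P + M * (z * w))
         = (r * (P + phi * M * (z * w) + m * (w * y)) - N * w) * (y + phi * q * M * z)
           + w * (y * (N * (1 - m) + 2 * m + (2 * m + phi * (2 * m - 1 - (q + 2) * m)) * (M * r * z))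
                  + phi * (1 - phi) * q * M\<^sup>2 * r * z\<^sup>2)"
    (is "?L = ?R")
proof -
  have "?L - ?R = M * z * w * (phi * (N + q) - N)"
    unfolding v by (simp add: algebra_simps power2_eq_square)
  then show ?thesis
    using phi by simp
qed

text \<open>The natural length is \<open>K = M^(-1/q)\<close>. Both \<open>w\<close> and the radius
  under study are of order \<open>K\<close>, so \<open>u\<close> drops only by order
  \<open>K^2\<close>; meanwhile \<open>u \<ge> 1/2\<close> forces \<open>w\<close> to grow linearly
  until \<open>riccati_bound\<close> fails.\<close>

lemma no_profile_for_large_M:
  assumes q: "q > 1"
  obtains M1 where "M1 > 0" "\<And>M u w. M > M1 \<Longrightarrow> u 0 = 1 \<Longrightarrow> \<not> radial_profile d u w p q M"
proof -
  define N where "N = real d + 1"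
  have N: "N \<ge> 1" by (simp add: N_def)
  \<comment> \<open>Constants in units of \<open>K\<close>: \<open>C K\<close> bounds
    \<open>w\<close>, by \<open>riccati_bound\<close> beyond \<open>K / 2\<close>. While
    \<open>u \<ge> 1/2\<close>, \<open>w \<ge> a r\<close>, and \<open>a^(q-1) S^q = 2 N\<close>
    makes this contradict \<open>riccati_bound\<close> at radius \<open>S K\<close>. Finally
    \<open>M1\<close> is chosen so that the drop \<open>C K * S K\<close> of \<open>u\<close> is at
    most \<open>1/2\<close>.\<close>
  define C where "C = (4 * N) powr (1 / (q - 1))"
  define a where "a = 2 powr (-p) / N"
  define S where "S = (2 * N / a powr (q - 1)) powr (1 / q)"
  have a: "a > 0" and S: "S > 0" and C: "C \<ge> 1"
    using N q by (auto simp: a_def S_def C_def ge_one_powr_ge_zero)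
  define M1 where "M1 = (2 * C * S) powr (q / 2)"
  have "M1 > 0"
    using S C by (simp add: M1_def)
  moreover have False if M: "M > M1" and u0: "u 0 = 1" and prof: "radial_profile d u w p q M" for M u w
  proof -
    interpret radial_profile d u w p q M by fact
    define K where "K = M powr (-1/q)"
    have K: "K > 0"
      using M_pos by (simp add: K_def)
    have MK: "M * K powr q = 1"
      using M_pos q by (simp add: K_def powr_powr powr_neg_one)
    have K2: "2 * C * S * K\<^sup>2 \<le> 1"
    proof -
      have "M1 powr (2/q) \<le> M powr (2/q)"
        using M \<open>M1 > 0\<close> q by (intro powr_mono2) auto
      then have "2 * C * S \<le> M powr (2/q)"
        using q C S by (simp add: M1_def powr_powr)
      then have "2 * C * S * M powr (-2/q) \<le> M powr (2/q) * M powr (-2/q)"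
        by (intro mult_right_mono) auto
      also have "\<dots> = 1"
        using M_pos by (simp flip: powr_add)
      also have "M powr (-2/q) = K\<^sup>2"
        using M_pos by (simp add: K_def powr_powr flip: powr_numeral)
      finally show ?thesis .
    qed
    have w_le: "w r \<le> C * K" if r: "r \<ge> 0" for r
    proof (cases "r \<le> K / 2")
      case True
      then have "w r \<le> 2 * r"
        using w_early[OF u0 r] by (simp add: K_def)
      also have "2 * r \<le> 1 * K"
        using True by simp
      also have "\<dots> \<le> C * K"
        using C K by (intro mult_right_mono) auto
      finally show ?thesis .
    next
      case False
      then have r: "r > K / 2" "r > 0"
        using K by auto
      have ww: "w r > 0"
        using w_positive r by auto
      have "w r powr (q - 1) * (M * (K / 2)) \<le> w r powr (q - 1) * (M * r)"
        using r M_pos by (intro mult_left_mono) auto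
      also have "\<dots> \<le> 2 * N"
        using riccati_bound[OF r(2)] by (simp add: N_def mult_ac)
      finally have "w r powr (q - 1) * (M * K) \<le> 4 * N"
        by simp
      then have "w r powr (q - 1) * (M * K) * K powr (q - 1) \<le> 4 * N * K powr (q - 1)"
        by (intro mult_right_mono) auto
      moreover have "w r powr (q - 1) * (M * K) * K powr (q - 1) = w r powr (q - 1)"
        using MK K by (simp add: powr_diff)
      ultimately have "(w r powr (q - 1)) powr (1 / (q - 1)) \<le> (4 * N * K powr (q - 1)) powr (1 / (q - 1))"
        using q by (intro powr_mono2) auto
      then show ?thesis
        using ww K N q by (simp add: powr_powr powr_mult C_def)
    qed
    define R where "R = S * K"
    have R: "R > 0"
      using S K by (simp add: R_def)
    have u_half: "1/2 \<le> u s" if s: "0 \<le> s" "s \<le> R" for s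
    proof -
      have "u 0 + C * K * 0 \<le> u s + C * K * s"
      proof (rule DERIV_nonneg_imp_nondecreasing[OF s(1)])
        fix x assume "0 \<le> x" "x \<le> s"
        then show "\<exists>y. ((\<lambda>x. u x + C * K * x) has_real_derivative y) (at x) \<and> 0 \<le> y"
          using w_le[of x] deriv_u[of x]
          by (intro exI[of _ "C * K - w x"]) (auto intro!: derivative_eq_intros)
      qed
      moreover have "C * K * s \<le> C * K * R"
        using s C K by (intro mult_left_mono) auto
      moreover have "C * K * R \<le> 1/2"
        using K2 by (simp add: R_def power2_eq_square mult_ac)
      ultimately show ?thesis
        using u0 by simp
    qed
    have "(1/2) powr p * R / (real d + 1) \<le> w R"
    proof (rule w_lower_bound[OF R])
      fix s assume s: "0 < s" "s < R"
      have "(1/2) powr p \<le> u s powr p"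
        using u_half[of s] s p_gt_1 by (intro powr_mono2) auto
      then show "(1/2) powr p \<le> u s powr p + M * w s powr q"
        using M_pos by (simp add: add_increasing2)
    qed
    then have "a * R \<le> w R"
      by (simp add: a_def N_def powr_minus powr_divide divide_simps)
    then have "(a * R) powr (q - 1) \<le> w R powr (q - 1)"
      using a R q by (intro powr_mono2) auto
    then have "M * (a * R) powr (q - 1) * R \<le> M * w R powr (q - 1) * R"
      using M_pos R by (intro mult_right_mono mult_left_mono) auto
    also have "\<dots> < 2 * N"
      using riccati_bound[OF R] by (simp add: N_def)
    finally have "M * (a * R) powr (q - 1) * R < 2 * N" .
    moreover have "M * (a * R) powr (q - 1) * R = a powr (q - 1) * S powr q * (M * K powr q)"
      using a S K by (simp add: R_def powr_mult powr_diff)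
    moreover have "S powr q = 2 * N / a powr (q - 1)"
      using q N a by (simp add: S_def powr_powr)
    ultimately show False
      using a MK by simp
  qed
  ultimately show ?thesis
    using that by blast
qed

subsection \<open>The subcritical case\<close>

text \<open>The hypotheses give \<open>u \<le> c^(1/(1-p)) r^(2/(1-p))\<close> and then
  \<open>w \<le> B r^(2/(1-p) - 1)\<close>, so the weight is at most a constant times
  \<open>r^e\<close> with \<open>e (p - 1) = 2p - q (p + 1)\<close>. The hypothesis on
  \<open>q\<close> says exactly \<open>e \<le> 0\<close>. The constant depends neither on
  \<open>M\<close> nor on the profile; radii below \<open>1/2\<close> are left to the early
  bound.\<close>

lemma weight_decay:
  fixes A p q N :: real
  assumes p: "p > 1" and q: "q \<ge> 2 * p / (p + 1)" and N: "N > 0" and A: "A > 0"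
  obtains C where "C > 0"
    "\<And>r u w. r \<ge> 1/2 \<Longrightarrow> u > 0 \<Longrightarrow> w \<ge> 0 \<Longrightarrow> (p - 1) / (2 * N) * r\<^sup>2 \<le> u powr (1 - p) \<Longrightarrow>
       r * w \<le> A * u \<Longrightarrow> r * w powr (q - 1) \<le> C"
proof -
  have "2 * p / (p + 1) > 1"
    using p by (simp add: field_simps)
  with q have q1: "q > 1"
    by linarith
  define c where "c = (p - 1) / (2 * N)"
  have c: "c > 0"
    using p N by (simp add: c_def)
  define B where "B = A * c powr (1 / (1 - p))"
  have B: "B > 0"
    using A c by (simp add: B_def)
  define e where "e = 1 + (2 / (1 - p) - 1) * (q - 1)"
  have e: "e \<le> 0"
  proof -
    have "e * (p - 1) = 2 * p - q * (p + 1)"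
      using p by (simp add: e_def field_simps)
    also have "\<dots> \<le> 0"
      using q p by (simp add: field_simps)
    finally show ?thesis
      using p by (simp add: mult_le_0_iff)
  qed
  have "r * w powr (q - 1) \<le> B powr (q - 1) * (1/2) powr e"
    if r: "r \<ge> 1/2" and u: "u > 0" and w: "w \<ge> 0" and decay: "c * r\<^sup>2 \<le> u powr (1 - p)"
      and rw: "r * w \<le> A * u" for r u w :: real
  proof -
    have r0: "r > 0"
      using r by simp
    have "(u powr (1 - p)) powr (1 / (1 - p)) \<le> (c * r\<^sup>2) powr (1 / (1 - p))"
      using decay c r0 p by (intro powr_mono2') auto
    also have "\<dots> = c powr (1 / (1 - p)) * r powr (2 / (1 - p))"
      using c r0 by (simp add: powr_mult powr_powr flip: powr_numeral)
    finally have "u \<le> c powr (1 / (1 - p)) * r powr (2 / (1 - p))"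
      using u p by (simp add: powr_powr)
    then have "A * u \<le> A * (c powr (1 / (1 - p)) * r powr (2 / (1 - p)))"
      using A by (intro mult_left_mono) auto
    then have "r * w \<le> B * r powr (2 / (1 - p))"
      using rw by (simp add: B_def mult.assoc)
    then have "w \<le> B * r powr (2 / (1 - p)) / r"
      using r0 by (simp add: field_simps)
    also have "\<dots> = B * r powr (2 / (1 - p) - 1)"
      using r0 by (simp add: powr_diff)
    finally have "w powr (q - 1) \<le> (B * r powr (2 / (1 - p) - 1)) powr (q - 1)"
      using w q1 by (intro powr_mono2) auto
    also have "\<dots> = B powr (q - 1) * r powr ((2 / (1 - p) - 1) * (q - 1))"
      using B by (simp add: powr_mult powr_powr)
    finally have "r * w powr (q - 1) \<le> r * (B powr (q - 1) * r powr ((2 / (1 - p) - 1) * (q - 1)))"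
      using r0 by (intro mult_left_mono) auto
    also have "\<dots> = B powr (q - 1) * r powr e"
      using r0 by (simp add: e_def powr_add)
    also have "\<dots> \<le> B powr (q - 1) * (1/2) powr e"
      using e r by (intro mult_left_mono powr_mono2') auto
    finally show ?thesis .
  qed
  moreover have "B powr (q - 1) * (1/2) powr e > 0"
    using B by simp
  ultimately show ?thesis
    using that unfolding c_def by blast
qed

context radial_profile
begin

text \<open>
  With \<open>X = r w / u\<close>, \<open>Y = r u\<^sup>p / w\<close>, \<open>Z = M r w\<^sup>q\<^sup>-\<^sup>1\<close> the function below is
  \<open>r\<^sup>N\<^sup>-\<^sup>1 w (Y + \<phi> Z + m X - N)\<close>. At the critical exponent, \<open>Y + m X = N\<close> is the identity satisfied by
  the bubbles when \<open>M = 0\<close>; the value of \<open>\<phi>\<close> is the one that removes the term linear in \<open>Z\<close> alone from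
  the differential inequality.
\<close>

lemma bubble_comparison:
  fixes m N phi :: real
  defines "m \<equiv> (p + 1) / 2" and "N \<equiv> real d + 1"
  defines "phi \<equiv> N / (N + q)"
  assumes nonneg: "\<And>r. r > 0 \<Longrightarrow>
      0 \<le> N * (1 - m) + 2 * m + (2 * m + phi * (p - (q + 2) * m)) * (M * (r * w r powr (q - 1)))"
    and R: "R \<ge> 0"
  shows "0 \<le> R ^ Suc d * (u R powr p + phi * M * w R powr q + m * (w R)\<^sup>2 / u R) - N * (R ^ d * w R)"
proof -
  have N: "N \<ge> 1" and p: "p = 2 * m - 1" and m: "m > 1"
    using p_gt_1 by (simp_all add: N_def m_def field_simps)
  have phi: "phi * (N + q) = N" "0 < phi" "phi \<le> 1"
    using N q_gt_1 by (auto simp: phi_def)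
  define D where "D r = r ^ Suc d * (u r powr p + phi * M * w r powr q + m * (w r)\<^sup>2 / u r) - N * (r ^ d * w r)" for r
  \<comment> \<open>\<open>a\<close> and \<open>b\<close> are the factor and, up to
    \<open>r^d\<close>, the remainder in \<open>subcritical_identity\<close>. The assumption
    \<open>nonneg\<close> is the sign of the first part of \<open>b\<close>; the second part is
    nonnegative because \<open>0 < phi \<le> 1\<close>.\<close>
  define a where "a r = w r / u r + phi * q * M * w r powr (q - 1)" for r
  define b where "b r = r ^ d * w r * (w r / u r * (N * (1 - m) + 2 * m + (2 * m + phi * (p - (q + 2) * m)) * (M * (r * w r powr (q - 1))))
      + phi * (1 - phi) * q * M\<^sup>2 * r * (w r powr (q - 1))\<^sup>2)" for r
  have "0 \<le> D R"
  proof (rule linear_differential_inequality[OF R])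
    have cw: "continuous_on {0..R} w" and cu: "continuous_on {0..R} u"
      using cont_w cont_u by (auto intro: continuous_on_subset)
    have u0: "u r \<noteq> 0" if "r \<in> {0..R}" for r
      using u_pos[of r] that by auto
    \<comment> \<open>\<open>w\<close> vanishes at 0, so its powers are continuous there only for
      positive exponents, here \<open>q\<close> and \<open>q - 1\<close>.\<close>
    have cq: "continuous_on {0..R} (\<lambda>r. w r powr e)" if "e > 0" for e
      by (rule continuous_on_powr'[OF cw continuous_on_const]) (use w_nonneg that in auto)
    have cp: "continuous_on {0..R} (\<lambda>r. u r powr p)"
      by (intro continuous_intros cu) (use u0 in auto)
    show "continuous_on {0..R} a"
      unfolding a_def by (intro continuous_intros cw cu cq) (use u0 q_gt_1 in auto)
    show "continuous_on {0..R} D"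
      unfolding D_def by (intro continuous_intros cw cu cq cp) (use u0 q_gt_1 in auto)
    show "D 0 \<ge> 0"
      by (simp add: D_def w_zero)
    fix r assume r: "0 < r" "r < R"
    have ur: "u r > 0" and wr: "w r > 0"
      using u_pos w_positive r by auto
    have "0 \<le> phi * (1 - phi) * q * M\<^sup>2 * r * (w r powr (q - 1))\<^sup>2"
      using phi q_gt_1 r by simp
    moreover have "0 \<le> w r / u r" "0 \<le> r ^ d * w r"
      using ur wr r by auto
    ultimately show "b r \<ge> 0"
      unfolding b_def using mult_nonneg_nonneg[OF _ nonneg[OF r(1)]]
      by (metis add_nonneg_nonneg mult_nonneg_nonneg)
    define y where "y = w r / u r"
    define z where "z = w r powr (q - 1)"
    define P where "P = u r powr p"
    define w' where "w' = P + M * w r powr q - real d / r * w r"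
    have wq: "w r powr q = z * w r"
      using wr by (simp add: z_def powr_diff)
    have dw: "(w has_real_derivative w') (at r)"
      using deriv_w[OF r(1)] by (simp add: w'_def P_def)
    have d1: "((\<lambda>r. u r powr p) has_real_derivative - (2 * m - 1) * P * y) (at r)"
      by (rule DERIV_cong[OF has_real_derivative_powr_const[OF deriv_u ur]])
        (use ur in \<open>simp add: P_def y_def powr_diff flip: p\<close>)
    have d2: "((\<lambda>r. phi * M * w r powr q) has_real_derivative phi * M * (q * z * w')) (at r)"
      by (intro DERIV_cmult) (use has_real_derivative_powr_const[OF dw wr, of q] in \<open>simp add: z_def\<close>)
    have d3: "((\<lambda>r. m * (w r)\<^sup>2 / u r) has_real_derivative m * (2 * y * w' + w r * y\<^sup>2)) (at r)"
      by (rule DERIV_cong[OF DERIV_divide[OF DERIV_cmult[OF DERIV_power[OF dw]] deriv_u]])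
        (use ur in \<open>auto simp: y_def field_simps power2_eq_square\<close>)
    have d4: "((\<lambda>r. r ^ Suc d) has_real_derivative N * r ^ d) (at r)"
      using DERIV_pow[of "Suc d" r] by (simp add: N_def add.commute)
    have "(D has_real_derivative
        N * r ^ d * (u r powr p + phi * M * w r powr q + m * (w r)\<^sup>2 / u r)
        + (- (2 * m - 1) * P * y + phi * M * (q * z * w') + m * (2 * y * w' + w r * y\<^sup>2)) * r ^ Suc d
        - N * (r ^ d * (u r powr p + M * w r powr q))) (at r)"
      unfolding D_def
      by (intro DERIV_diff DERIV_mult DERIV_add DERIV_cmult d1 d2 d3 d4 deriv_flux r)
    moreover have "N * r ^ d * (u r powr p + phi * M * w r powr q + m * (w r)\<^sup>2 / u r)
        + (- (2 * m - 1) * P * y + phi * M * (q * z * w') + m * (2 * y * w' + w r * y\<^sup>2)) * r ^ Suc d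
        - N * (r ^ d * (u r powr p + M * w r powr q)) = D r * a r + b r"
    proof -
      have factor: "s * ((t * G - n * W) * B + W * E) = (t * s * G - n * (s * W)) * B + s * W * E"
        for s t G n W B E :: real
        by (simp add: algebra_simps)
      have mw: "m * (w r)\<^sup>2 / u r = m * (w r * y)"
        by (simp add: y_def power2_eq_square)
      have v: "r * w' = r * P + r * M * z * w r - (N - 1) * w r"
        using r by (simp add: w'_def wq N_def algebra_simps)
      have "N * r ^ d * (P + phi * M * (z * w r) + m * (w r * y))
          + (- (2 * m - 1) * P * y + phi * M * (q * z * w') + m * (2 * y * w' + w r * y\<^sup>2)) * r ^ Suc d
          - N * (r ^ d * (P + M * (z * w r)))
        = r ^ d * (N * (P + phi * M * (z * w r) + m * (w r * y))
           + (- r * (2 * m - 1) * P * y + phi * M * (q * z * (r * w')) + m * (2 * y * (r * w') + r * w r * y\<^sup>2))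
           - N * (P + M * (z * w r)))"
        by (simp add: algebra_simps)
      also have "\<dots> = r ^ d * ((r * (P + phi * M * (z * w r) + m * (w r * y)) - N * w r) * (y + phi * q * M * z)
           + w r * (y * (N * (1 - m) + 2 * m + (2 * m + phi * (2 * m - 1 - (q + 2) * m)) * (M * r * z))
                  + phi * (1 - phi) * q * M\<^sup>2 * r * z\<^sup>2))"
        by (subst subcritical_identity[OF phi(1) v]) (rule refl)
      also have "\<dots> = D r * a r + b r"
        unfolding D_def a_def b_def mw wq
        unfolding y_def[symmetric] z_def[symmetric] P_def[symmetric] p[symmetric]
        by (subst factor) (simp add: mult.assoc)
      finally show ?thesis
        unfolding mw wq P_def .
    qed
    ultimately show "(D has_real_derivative D r * a r + b r) (at r)"
      by simp
  qed
  then show ?thesis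
    by (simp only: D_def)
qed

text \<open>Two decay rates collide: monotonicity of \<open>w / (r u^m)\<close> gives
  \<open>u = O(r^(-2/(m-1))) = O(r^(-4/(p-1)))\<close>, whereas the increasing flux gives
  \<open>u \<ge> c1 r^(1-d)\<close>. They are incompatible because
  \<open>(d - 1)(p - 1) < 4\<close>.\<close>

lemma subcritical_contradiction:
  fixes m N phi :: real
  defines "m \<equiv> (p + 1) / 2" and "N \<equiv> real d + 1"
  defines "phi \<equiv> N / (N + q)"
  assumes nonneg: "\<And>r. r > 0 \<Longrightarrow>
      0 \<le> N * (1 - m) + 2 * m + (2 * m + phi * (p - (q + 2) * m)) * (M * (r * w r powr (q - 1)))"
    and subcrit: "(real d - 1) * (p - 1) < 4"
  shows False
proof -
  have m: "m > 1" and phi: "0 < phi" "phi \<le> 1"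
    using p_gt_1 q_gt_1 by (auto simp: m_def N_def phi_def)
  define h where "h r = w r * inverse r * u r powr (-m)" for r
  have h_mono: "h 1 \<le> h r" if r: "1 \<le> r" for r
  proof (rule DERIV_nonneg_imp_nondecreasing[OF r])
    fix s assume "1 \<le> s" "s \<le> r"
    then have s: "s > 0" by simp
    have us: "u s > 0" and ws: "w s > 0"
      using u_pos w_positive s by auto
    define w' where "w' = u s powr p + M * w s powr q - real d / s * w s"
    have dw: "(w has_real_derivative w') (at s)"
      using deriv_w[OF s] by (simp add: w'_def)
    have "s ^ d * (N * w s) \<le> s ^ d * (s * (u s powr p + phi * M * w s powr q + m * (w s)\<^sup>2 / u s))"
      using bubble_comparison[OF nonneg[unfolded m_def N_def phi_def], of s] s
      by (simp add: m_def N_def phi_def algebra_simps)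
    then have "N * w s \<le> s * (u s powr p + phi * M * w s powr q + m * (w s)\<^sup>2 / u s)"
      using mult_le_cancel_left_pos[of "s ^ d"] zero_less_power[OF s] by blast
    \<comment> \<open>Raising \<open>phi\<close> to 1 completes the forcing term, so that
      \<open>w'\<close> can be substituted. What remains is the sign of the logarithmic derivative
      of \<open>h\<close>, multiplied by \<open>w\<close>.\<close>
    also have "\<dots> \<le> s * (u s powr p + 1 * M * w s powr q + m * (w s)\<^sup>2 / u s)"
      using phi s M_pos by (intro mult_left_mono add_mono mult_right_mono) auto
    finally have "N * w s / s \<le> u s powr p + M * w s powr q + m * (w s)\<^sup>2 / u s"
      using s by (simp add: field_simps)
    then have "0 \<le> w' - w s / s + m * (w s)\<^sup>2 / u s"
      by (simp add: w'_def N_def add_divide_distrib distrib_right)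
    then have "0 \<le> (w' - w s / s + m * (w s)\<^sup>2 / u s) * (inverse s * u s powr (-m))"
      using s by (intro mult_nonneg_nonneg) auto
    moreover have "(h has_real_derivative
        (w' * inverse s + - (inverse s ^ Suc (Suc 0)) * w s) * u s powr (-m)
        + (-m * u s powr (-m - 1) * - w s) * (w s * inverse s)) (at s)"
      unfolding h_def
      by (intro DERIV_mult dw DERIV_inverse has_real_derivative_powr_const deriv_u us) (use s in auto)
    moreover have "(w' * inverse s + - (inverse s ^ Suc (Suc 0)) * w s) * u s powr (-m)
        + (-m * u s powr (-m - 1) * - w s) * (w s * inverse s)
        = (w' - w s / s + m * (w s)\<^sup>2 / u s) * (inverse s * u s powr (-m))"
      using us s by (simp add: powr_diff field_simps power2_eq_square)
    ultimately show "\<exists>y. (h has_real_derivative y) (at s) \<and> 0 \<le> y"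
      by metis
  qed
  define c where "c = h 1"
  have c: "c > 0"
    using u_pos[of 1] w_positive[of 1] by (simp add: c_def h_def)
  have w_ge: "c * r \<le> w r * u r powr (-m)" if "1 \<le> r" for r
    using h_mono[OF that] that by (simp add: c_def h_def field_simps)
  define k where "k = (m - 1) * c / 2"
  have k: "k > 0"
    using m c by (simp add: k_def)
  have upper: "k * (r\<^sup>2 - 1) \<le> u r powr (1 - m)" if r: "1 \<le> r" for r
  proof -
    have "u 1 powr (1 - m) - k * 1\<^sup>2 \<le> u r powr (1 - m) - k * r\<^sup>2"
    proof (rule DERIV_nonneg_imp_nondecreasing[OF r])
      fix s assume s: "1 \<le> s" "s \<le> r"
      then have us: "u s > 0"
        using u_pos by simp
      have "((\<lambda>r. k * r\<^sup>2) has_real_derivative 2 * k * s) (at s)"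
        by (auto intro!: derivative_eq_intros)
      then have "((\<lambda>r. u r powr (1 - m) - k * r\<^sup>2) has_real_derivative
          (1 - m) * u s powr (1 - m - 1) * - w s - 2 * k * s) (at s)"
        by (intro DERIV_diff has_real_derivative_powr_const deriv_u us)
      moreover have "0 \<le> (m - 1) * (w s * u s powr (-m) - c * s)"
        using w_ge[of s] s m by (intro mult_nonneg_nonneg) auto
      moreover have "(1 - m) * u s powr (1 - m - 1) * - w s - 2 * k * s = (m - 1) * (w s * u s powr (-m) - c * s)"
      proof -
        have k2: "2 * k = (m - 1) * c"
          by (simp add: k_def)
        show ?thesis
          unfolding k2 by (simp add: algebra_simps)
      qed
      ultimately show "\<exists>y. ((\<lambda>r. u r powr (1 - m) - k * r\<^sup>2) has_real_derivative y) (at s) \<and> 0 \<le> y"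
        by metis
    qed
    then have "u 1 powr (1 - m) + k * (r\<^sup>2 - 1) \<le> u r powr (1 - m)"
      by (simp add: algebra_simps)
    then show ?thesis
      using powr_ge_zero[of "u 1" "1 - m"] by linarith
  qed
  define c1 where "c1 = w 1 / 2 ^ d"
  have c1: "c1 > 0"
    using w_positive[of 1] by (simp add: c1_def)
  \<comment> \<open>Combining \<open>rw_le_u\<close> with the flux, instead of integrating
    \<open>w\<close> up to infinity, treats all dimensions at once, including \<open>N = 1\<close>
    and \<open>N = 2\<close>.\<close>
  have lower: "c1 * r powr (1 - real d) \<le> u r" if r: "1 \<le> r" for r
  proof -
    have "w 1 * r \<le> r ^ d * w r * r"
      using flux_mono[OF _ r less_imp_le[OF forcing_pos]] r by (intro mult_right_mono) auto
    also have "\<dots> \<le> r ^ d * (2 ^ d * u r)"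
      using mult_left_mono[OF rw_le_u[of r], of "r ^ d"] r by (simp add: mult_ac)
    finally have "w 1 * r / r ^ d \<le> 2 ^ d * u r"
      using r by (simp add: field_simps)
    moreover have "r powr (1 - real d) = r / r ^ d"
      using r by (simp add: powr_diff powr_realpow)
    ultimately have "w 1 * r powr (1 - real d) \<le> 2 ^ d * u r"
      by simp
    then have "w 1 * r powr (1 - real d) / 2 ^ d \<le> u r"
      by (simp add: divide_le_eq mult.commute)
    then show ?thesis
      by (simp add: c1_def)
  qed
  define e where "e = (real d - 1) * (m - 1)"
  have e: "e < 2"
    using subcrit by (simp add: e_def m_def field_simps)
  define K where "K = c1 powr (1 - m)"
  have main: "k * (r\<^sup>2 - 1) \<le> K * r powr e" if r: "1 \<le> r" for r
  proof -
    have "u r powr (1 - m) \<le> (c1 * r powr (1 - real d)) powr (1 - m)"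
      using lower[OF r] c1 r m by (intro powr_mono2') auto
    also have "\<dots> = K * r powr ((1 - real d) * (1 - m))"
      using c1 by (simp add: K_def powr_mult powr_powr)
    also have "(1 - real d) * (1 - m) = e"
      by (simp add: e_def algebra_simps)
    finally show ?thesis
      using upper[OF r] by linarith
  qed
  have K: "K > 0"
    using c1 by (simp add: K_def)
  \<comment> \<open>For large \<open>r\<close>, \<open>r powr (2 - e) \<ge> b\<close>, and
    \<open>r \<ge> 2\<close> gives \<open>r^2 - 1 \<ge> r^2 / 2\<close>. Then \<open>main\<close>
    yields \<open>k b \<le> 2 K\<close>, which the summand 1 in \<open>b\<close> excludes.\<close>
  define b where "b = 2 * K / k + 1"
  have b: "b > 0"
    using K k by (simp add: b_def add_pos_pos)
  define r where "r = max 2 (b powr (1 / (2 - e)))"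
  have r: "r \<ge> 2" "r \<ge> b powr (1 / (2 - e))"
    by (auto simp: r_def)
  have "(b powr (1 / (2 - e))) powr (2 - e) \<le> r powr (2 - e)"
    using r e by (intro powr_mono2) auto
  then have "b \<le> r powr (2 - e)"
    using b e by (simp add: powr_powr)
  also have "\<dots> = r\<^sup>2 / r powr e"
    using r by (simp add: powr_diff flip: powr_numeral)
  finally have "b * r powr e \<le> r\<^sup>2"
    using r by (simp add: field_simps)
  moreover have "r\<^sup>2 / 2 \<le> r\<^sup>2 - 1"
    using power_mono[of 2 r 2] r by simp
  ultimately have "k * (b * r powr e / 2) \<le> k * (r\<^sup>2 - 1)"
    using k by (intro mult_left_mono) auto
  also have "\<dots> \<le> K * r powr e"
    using main r by auto
  finally have "k * b / 2 \<le> K"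
    using r by (simp add: field_simps)
  moreover have "k * b = 2 * K + k"
    using k by (simp add: b_def distrib_left)
  ultimately show False
    using k by linarith
qed

end

text \<open>Both coefficients are nonnegative. The constant one is \<open>N - (N - 2) m\<close>,
  whose sign expresses subcriticality. The one of \<open>M r w^(q-1)\<close> is
  \<open>(N p - (N - 2) m q) / (N + q)\<close>, which follows from \<open>(N - 2) m \<le> N\<close>
  and \<open>q \<le> p\<close>. Hence neither the size of \<open>M\<close> nor \<open>u 0\<close>
  enters.\<close>

lemma no_profile_subcritical:
  assumes "q \<le> p" and subcrit: "(real d - 1) * (p - 1) < 4"
  shows "\<not> radial_profile d u w p q M"
proof
  assume "radial_profile d u w p q M"
  then interpret radial_profile d u w p q M .
  define m N phi where defs: "m = (p + 1) / 2" "N = real d + 1" "phi = N / (N + q)"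
  have "N * (1 - m) + 2 * m \<ge> 0"
    using subcrit by (simp add: defs field_simps)
  moreover have "2 * m + phi * (p - (q + 2) * m) \<ge> 0"
  proof -
    have N: "N > 0" and m: "m > 0"
      using p_gt_1 by (auto simp: defs)
    have le: "(N - 2) * m \<le> N"
      using subcrit by (simp add: defs field_simps)
    have "(N - 2) * m * q \<le> N * p"
    proof (cases "N \<ge> 2")
      case True
      then show ?thesis
        using le m q_gt_1 p_gt_1 \<open>q \<le> p\<close> N by (intro mult_mono) auto
    next
      case False
      then have "(N - 2) * m * q \<le> 0"
        using m q_gt_1 by (intro mult_nonpos_nonneg) auto
      also have "0 \<le> N * p"
        using N p_gt_1 by simp
      finally show ?thesis .
    qed
    then have "0 \<le> (2 * m * (N + q) + N * (p - (q + 2) * m)) / (N + q)"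
      using N q_gt_1 by (intro divide_nonneg_pos) (auto simp: algebra_simps)
    also have "\<dots> = 2 * m + phi * (p - (q + 2) * m)"
      using N q_gt_1 by (simp add: defs(3) field_simps)
    finally show ?thesis .
  qed
  ultimately have "0 \<le> N * (1 - m) + 2 * m + (2 * m + phi * (p - (q + 2) * m)) * (M * (r * w r powr (q - 1)))"
    if "r > 0" for r
    by (rule add_nonneg_nonneg[OF _ mult_nonneg_nonneg]) (use that M_pos in auto)
  then show False
    using subcritical_contradiction subcrit unfolding defs by blast
qed

text \<open>For \<open>q > p\<close> the coefficient \<open>B\<close> may be negative, but strict
  subcriticality leaves \<open>a > 0\<close>, and a uniform bound on \<open>r w^(q-1)\<close> lets a
  small \<open>M\<close> absorb \<open>B\<close>. The bound is \<open>weight_decay\<close> beyond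
  \<open>1/2\<close>, available since \<open>q > p \<ge> 2p/(p+1)\<close>, and
  \<open>w_early\<close> before, where \<open>u 0 = 1\<close> and \<open>M \<le> 1\<close> are
  used.\<close>

lemma no_profile_for_small_M:
  assumes p: "p > 1" and q: "q > p" and subcrit: "(real d - 1) * (p - 1) < 4"
  obtains M2 where "M2 > 0" "\<And>M u w. M < M2 \<Longrightarrow> u 0 = 1 \<Longrightarrow> \<not> radial_profile d u w p q M"
proof -
  define m N phi where defs: "m = (p + 1) / 2" "N = real d + 1" "phi = N / (N + q)"
  define a where "a = N * (1 - m) + 2 * m"
  define B where "B = 2 * m + phi * (p - (q + 2) * m)"
  have a: "a > 0"
    using subcrit by (simp add: a_def defs field_simps)
  have "2 * p / (p + 1) \<le> p"
    using p by (simp add: field_simps)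
  then have q': "q \<ge> 2 * p / (p + 1)"
    using q by simp
  obtain C0 where C0: "C0 > 0"
    "\<And>r u w. r \<ge> 1/2 \<Longrightarrow> u > 0 \<Longrightarrow> w \<ge> 0 \<Longrightarrow> (p - 1) / (2 * (real d + 1)) * r\<^sup>2 \<le> u powr (1 - p) \<Longrightarrow>
       r * w \<le> 2 ^ d * u \<Longrightarrow> r * w powr (q - 1) \<le> C0"
    using weight_decay[OF p q', of "real d + 1" "2 ^ d"] by (auto simp: add_pos_pos)
  define C where "C = max C0 1"
  \<comment> \<open>The cap 1 makes the range of \<open>w_early\<close> contain
    \<open>[0, 1/2]\<close>; \<open>\<bar>B\<bar> + 1\<close> keeps the denominator positive when
    \<open>B = 0\<close>.\<close>
  define M2 where "M2 = min 1 (a / ((\<bar>B\<bar> + 1) * C))"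
  have "M2 > 0"
    using a by (auto simp: M2_def C_def intro!: divide_pos_pos mult_pos_pos)
  moreover have False if M: "M < M2" and u0: "u 0 = 1" and prof: "radial_profile d u w p q M" for M u w
  proof -
    interpret radial_profile d u w p q M by fact
    have C: "r * w r powr (q - 1) \<le> C" if r: "r > 0" for r
    proof (cases "r \<le> 1/2")
      case True
      have "1 \<le> M powr (-1/q)"
        using M M_pos q_gt_1 powr_mono2'[of "-1/q" M 1] by (auto simp: M2_def)
      then have "w r \<le> 2 * r"
        using True r by (intro w_early[OF u0]) auto
      then have "w r powr (q - 1) \<le> 1 powr (q - 1)"
        using True r q_gt_1 w_nonneg by (intro powr_mono2) auto
      then have "r * w r powr (q - 1) \<le> 1 * 1"
        using r True by (intro mult_mono) auto
      then show ?thesis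
        by (simp add: C_def)
    next
      case False
      then have "r * w r powr (q - 1) \<le> C0"
        using r by (intro C0(2)[of r "u r"] u_pos w_nonneg u_decay rw_le_u) auto
      then show ?thesis
        by (simp add: C_def)
    qed
    have "0 \<le> a + B * (M * (r * w r powr (q - 1)))" if r: "r > 0" for r
    proof -
      have "\<bar>B * (M * (r * w r powr (q - 1)))\<bar> \<le> (\<bar>B\<bar> + 1) * (M * C)"
        unfolding abs_mult using r M_pos C[OF r] by (intro mult_mono) auto
      also have "\<dots> \<le> (\<bar>B\<bar> + 1) * (a / ((\<bar>B\<bar> + 1) * C) * C)"
        using M by (intro mult_left_mono mult_right_mono) (auto simp: M2_def C_def)
      also have "\<dots> = a"
      proof -
        have "C > 0" "\<bar>B\<bar> + 1 > 0"
          by (auto simp: C_def)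
        then show ?thesis
          by simp
      qed
      finally show ?thesis
        by linarith
    qed
    then show False
      using subcritical_contradiction subcrit unfolding defs a_def B_def by blast
  qed
  ultimately show ?thesis
    using that by blast
qed

subsection \<open>Solving the radial equation\<close>

lemma integral_initial_has_derivative:
  fixes g :: "real \<Rightarrow> real"
  assumes "continuous_on UNIV g" "x > 0"
  shows "((\<lambda>u. integral {0..u} g) has_real_derivative g x) (at x)"
proof -
  have "((\<lambda>u. integral {0..u} g) has_vector_derivative g x) (at x within {0..x + 1})"
    using assms by (intro integral_has_vector_derivative continuous_on_subset[OF assms(1)]) auto
  then show ?thesis
    using assms(2) at_within_Icc_at[of 0 x "x + 1"]
    by (simp add: has_real_derivative_iff_has_vector_derivative)
qed

text \<open>For \<open>u < 0\<close> the interval is empty and the integral is 0, so the function is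
  its restriction to the half-line composed with \<open>max u 0\<close>.\<close>

lemma continuous_on_integral_initial:
  fixes g :: "real \<Rightarrow> real"
  assumes g: "continuous_on UNIV g"
  shows "continuous_on UNIV (\<lambda>u. integral {0..u} g)"
proof -
  have "continuous (at x within {0..}) (\<lambda>u. integral {0..u} g)" if "x \<ge> 0" for x
  proof -
    have "continuous_on {0..x + 1} (\<lambda>u. integral {0..u} g)"
      by (intro indefinite_integral_continuous_1 integrable_continuous_interval
          continuous_on_subset[OF g]) auto
    then have "continuous (at x within {0..x + 1}) (\<lambda>u. integral {0..u} g)"
      using that by (simp add: continuous_on_eq_continuous_within)
    moreover have "at x within {0..} = at x within {0..x + 1}"
      by (rule at_within_nhd[of x "{..<x + 1}"]) auto
    ultimately show ?thesis
      by simp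
  qed
  then have "continuous_on {0..} (\<lambda>u. integral {0..u} g)"
    by (simp add: continuous_on_eq_continuous_within)
  then have "continuous_on UNIV (\<lambda>u. integral {0..max u 0} g)"
    by (rule continuous_on_compose2) (auto intro!: continuous_intros)
  moreover have "integral {0..max u 0} g = integral {0..u} g" for u
    by (cases "u \<ge> 0") (auto simp: max_def)
  ultimately show ?thesis
    by simp
qed

text \<open>\<open>flux_quotient d g\<close> solves \<open>w' = g - (d / r) w\<close>, \<open>w(0) = 0\<close>.\<close>

definition flux_quotient :: "nat \<Rightarrow> (real \<Rightarrow> real) \<Rightarrow> real \<Rightarrow> real" where
  "flux_quotient d g r = integral {0..r} (\<lambda>s. s ^ d * g s) / r ^ d"

lemma flux_quotient_zero [simp]: "flux_quotient d g 0 = 0"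
  by (simp add: flux_quotient_def)

lemma flux_quotient_deriv:
  assumes g: "continuous_on UNIV g" and r: "r > 0"
  shows "(flux_quotient d g has_real_derivative g r - real d / r * flux_quotient d g r) (at r)"
proof -
  define J where "J r = integral {0..r} (\<lambda>s. s ^ d * g s)" for r
  have "(J has_real_derivative r ^ d * g r) (at r)"
    unfolding J_def by (rule integral_initial_has_derivative[OF _ r]) (intro continuous_intros g)
  then have "((\<lambda>r. J r / r ^ d) has_real_derivative
      (r ^ d * g r * r ^ d - J r * (real d * r ^ (d - Suc 0))) / (r ^ d * r ^ d)) (at r)"
    by (rule DERIV_divide[OF _ DERIV_pow]) (use r in auto)
  moreover have "(r ^ d * g r * r ^ d - J r * (real d * r ^ (d - Suc 0))) / (r ^ d * r ^ d)
      = g r - real d / r * (J r / r ^ d)"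
    using r by (cases d) (auto simp: field_simps)
  ultimately show ?thesis
    by (simp add: flux_quotient_def J_def flip: flux_quotient_def)
qed

lemma flux_quotient_bound:
  assumes g: "continuous_on UNIV g" and r: "r \<ge> 0" and B: "\<And>s. \<bar>g s\<bar> \<le> B"
  shows "\<bar>flux_quotient d g r\<bar> \<le> B * r"
proof -
  have "norm (integral {0..r} (\<lambda>s. s ^ d * g s)) \<le> r ^ d * B * (r - 0)"
  proof (rule integral_bound[OF r])
    show "continuous_on {0..r} (\<lambda>s. s ^ d * g s)"
      by (intro continuous_intros continuous_on_subset[OF g]) auto
    show "norm (s ^ d * g s) \<le> r ^ d * B" if "s \<in> {0..r}" for s
      unfolding real_norm_def abs_mult using that B by (intro mult_mono) (auto intro: power_mono)
  qed
  then show ?thesis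
    using r by (cases "r = 0") (auto simp: flux_quotient_def divide_simps mult_ac)
qed

text \<open>Integrating the exponential weight gains \<open>1 / l\<close>, and
  \<open>s^d \<le> r^d\<close> cancels the division, so the gain is uniform in \<open>r\<close>. For
  \<open>d = 0\<close> the flux quotient is the plain integral; this case later controls
  \<open>u\<close>.\<close>

lemma flux_quotient_diff:
  assumes g: "continuous_on UNIV g" and h: "continuous_on UNIV h" and r: "r \<ge> 0" and l: "l > 0"
    and K: "K \<ge> 0" and le: "\<And>s. s \<ge> 0 \<Longrightarrow> \<bar>g s - h s\<bar> \<le> K * exp (l * s)"
  shows "\<bar>flux_quotient d g r - flux_quotient d h r\<bar> \<le> K / l * exp (l * r)"
proof -
  have exp_int: "((\<lambda>s. exp (l * s)) has_integral (exp (l * r) / l - exp (l * 0) / l)) {0..r}"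
    using l r by (intro fundamental_theorem_of_calculus)
      (auto intro!: derivative_eq_intros simp flip: has_real_derivative_iff_has_vector_derivative)
  have int: "(\<lambda>s. s ^ d * f s) integrable_on {0..r}" if "continuous_on UNIV f" for f :: "real \<Rightarrow> real"
    by (intro integrable_continuous_interval continuous_intros continuous_on_subset[OF that]) auto
  have "integral {0..r} (\<lambda>s. s ^ d * g s) - integral {0..r} (\<lambda>s. s ^ d * h s)
      = integral {0..r} (\<lambda>s. s ^ d * g s - s ^ d * h s)"
    by (rule integral_diff[symmetric]; rule int; fact)
  also have "norm \<dots> \<le> integral {0..r} (\<lambda>s. r ^ d * K * exp (l * s))"
  proof (rule integral_norm_bound_integral)
    show "(\<lambda>s. s ^ d * g s - s ^ d * h s) integrable_on {0..r}"
      by (intro integrable_diff int g h)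
    show "(\<lambda>s. r ^ d * K * exp (l * s)) integrable_on {0..r}"
      using exp_int by (intro integrable_on_mult_right) blast
    fix s assume s: "s \<in> {0..r}"
    have "norm (s ^ d * g s - s ^ d * h s) = s ^ d * \<bar>g s - h s\<bar>"
      using s by (simp add: abs_mult flip: right_diff_distrib)
    also have "\<dots> \<le> r ^ d * (K * exp (l * s))"
      using s le by (intro mult_mono power_mono) auto
    finally show "norm (s ^ d * g s - s ^ d * h s) \<le> r ^ d * K * exp (l * s)"
      by simp
  qed
  also have "\<dots> = r ^ d * K * ((exp (l * r) - 1) / l)"
    using exp_int by (simp add: integral_unique diff_divide_distrib)
  also have "\<dots> \<le> r ^ d * K * (exp (l * r) / l)"
    using l r K by (intro mult_left_mono divide_right_mono) auto
  finally have "\<bar>integral {0..r} (\<lambda>s. s ^ d * g s) - integral {0..r} (\<lambda>s. s ^ d * h s)\<bar> \<le> r ^ d * (K / l * exp (l * r))"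
    by simp
  then show ?thesis
    using r l K by (cases "r = 0") (auto simp: flux_quotient_def divide_simps mult_ac simp flip: diff_divide_distrib)
qed

lemma continuous_on_flux_quotient:
  assumes g: "continuous_on UNIV g" and B: "\<And>s. \<bar>g s\<bar> \<le> B"
  shows "continuous_on UNIV (\<lambda>r. flux_quotient d g (max r 0))"
proof -
  have "continuous_on {0..} (flux_quotient d g)"
    unfolding continuous_on_eq_continuous_within
  proof
    fix r :: real assume "r \<in> {0..}"
    show "continuous (at r within {0..}) (flux_quotient d g)"
    proof (cases "r = 0")
      case True
      have "((\<lambda>r. B * r) \<longlongrightarrow> B * 0) (at 0 within {0..})"
        by (intro tendsto_intros)
      then have "((\<lambda>r. B * r) \<longlongrightarrow> 0) (at 0 within {0..})"
        by simp
      moreover have "eventually (\<lambda>r. norm (flux_quotient d g r) \<le> B * r) (at 0 within {0..})"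
        unfolding eventually_at_filter
        by (rule always_eventually) (simp add: flux_quotient_bound[OF g _ B])
      ultimately have "(flux_quotient d g \<longlongrightarrow> 0) (at 0 within {0..})"
        by (rule Lim_null_comparison[rotated])
      then show ?thesis
        using True by (simp add: continuous_within)
    next
      case False
      then have "isCont (flux_quotient d g) r"
        using \<open>r \<in> {0..}\<close> by (intro DERIV_isCont[OF flux_quotient_deriv[OF g]]) auto
      then show ?thesis
        by (rule continuous_at_imp_continuous_at_within)
    qed
  qed
  then show ?thesis
    by (rule continuous_on_compose2) (auto intro!: continuous_intros)
qed

text \<open>The integral from 0 agrees with one started at a negative \<open>c\<close>, which makes
  the derivative at 0 two-sided, as \<open>radial_ode\<close> demands of \<open>u\<close>.\<close>

lemma integral_of_vanishing_has_derivative: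
  fixes g :: "real \<Rightarrow> real"
  assumes g: "continuous_on UNIV g" and zero: "\<And>t. t \<le> 0 \<Longrightarrow> g t = 0"
  shows "((\<lambda>s. integral {0..s} g) has_real_derivative g x) (at x)"
proof -
  define c where "c = min x 0 - 1"
  have c: "c < 0" "c < x"
    by (auto simp: c_def)
  have neg: "integral {c..s} g = 0" if "s \<le> 0" for s
  proof -
    have "integral {c..s} g = integral {c..s} (\<lambda>_. 0)"
      using that zero by (intro integral_cong) auto
    then show ?thesis
      by simp
  qed
  have eq: "integral {c..s} g = integral {0..s} g" for s
  proof (cases "s \<ge> 0")
    case True
    have "g integrable_on {c..s}"
      by (intro integrable_continuous_interval continuous_on_subset[OF g]) auto
    then show ?thesis
      using Henstock_Kurzweil_Integration.integral_combine[of c 0 s g] neg[of 0] True c by simp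
  next
    case False
    then show ?thesis
      using neg[of s] by simp
  qed
  have "((\<lambda>u. integral {c..u} g) has_vector_derivative g x) (at x within {c..x + 1})"
    using c by (intro integral_has_vector_derivative continuous_on_subset[OF g]) auto
  then show ?thesis
    using c at_within_Icc_at[of c x "x + 1"]
    by (simp add: has_real_derivative_iff_has_vector_derivative eq)
qed

text \<open>
  Picard iteration for \<open>\<phi>(r) = exp (- l r) w(r)\<close> in the space of bounded continuous functions;
  a large weight \<open>l\<close> makes it a contraction on the whole half-line.
\<close>

lemma radial_ode_exists:
  fixes Phi Psi :: "real \<Rightarrow> real"
  assumes L: "L \<ge> 0"
    and Phi: "\<And>x y. \<bar>Phi x - Phi y\<bar> \<le> L * \<bar>x - y\<bar>" "\<And>x. \<bar>Phi x\<bar> \<le> B"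
    and Psi: "\<And>x y. \<bar>Psi x - Psi y\<bar> \<le> L * \<bar>x - y\<bar>" "\<And>x. \<bar>Psi x\<bar> \<le> B"
  obtains u w where "radial_ode d u w (\<lambda>r. Phi (u r) + Psi (w r))" "u 0 = 1"
proof -
  have cont_lip: "continuous_on UNIV F" if "\<And>x y. \<bar>F x - F y\<bar> \<le> L * \<bar>x - y\<bar>" for F :: "real \<Rightarrow> real"
    using that L by (intro lipschitz_on_continuous_on[of L UNIV F] lipschitz_onI) (auto simp: dist_real_def)
  have cPhi: "continuous_on UNIV Phi" and cPsi: "continuous_on UNIV Psi"
    by (rule cont_lip; fact)+
  \<comment> \<open>The contraction factor will be \<open>2 L / l \<le> 1/2\<close>;
    \<open>l \<ge> 1\<close> lets the integrated difference of \<open>U\<close> be bounded like that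
    of \<open>W\<close>.\<close>
  define l where "l = 4 * L + 1"
  have l: "l \<ge> 1"
    using L by (simp add: l_def)
  define W where "W \<phi> s = exp (l * s) * apply_bcontfun \<phi> s" for \<phi> :: "real \<Rightarrow>\<^sub>C real" and s
  define U where "U \<phi> s = 1 - integral {0..s} (W \<phi>)" for \<phi> s
  define H where "H \<phi> s = Phi (U \<phi> s) + Psi (W \<phi> s)" for \<phi> s
  have cW: "continuous_on S (W \<phi>)" for \<phi> S
    unfolding W_def by (intro continuous_intros continuous_on_apply_bcontfun)
  have cU: "continuous_on UNIV (U \<phi>)" for \<phi>
    unfolding U_def by (intro continuous_intros continuous_on_integral_initial cW)
  have cH: "continuous_on UNIV (H \<phi>)" for \<phi>
    unfolding H_def
    by (intro continuous_intros continuous_on_compose2[OF cPhi cU] continuous_on_compose2[OF cPsi cW]) auto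
  have bH: "\<bar>H \<phi> s\<bar> \<le> 2 * B" for \<phi> s
    unfolding H_def using Phi(2)[of "U \<phi> s"] Psi(2)[of "W \<phi> s"] by linarith
  have B: "B \<ge> 0"
    using Phi(2)[of 0] by linarith
  \<comment> \<open>The function space lives on the whole line, hence the extension through
    \<open>max r 0\<close>. Boundedness holds because the flux quotient grows at most linearly,
    against the factor \<open>exp (- l r)\<close>.\<close>
  define T where "T \<phi> = Bcontfun (\<lambda>r. exp (- l * max r 0) * flux_quotient d (H \<phi>) (max r 0))" for \<phi>
  have T: "apply_bcontfun (T \<phi>) r = exp (- l * max r 0) * flux_quotient d (H \<phi>) (max r 0)" for \<phi> r
  proof -
    have "(\<lambda>r. exp (- l * max r 0) * flux_quotient d (H \<phi>) (max r 0)) \<in> bcontfun"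
    proof (rule bcontfun_normI)
      show "continuous_on UNIV (\<lambda>r. exp (- l * max r 0) * flux_quotient d (H \<phi>) (max r 0))"
        by (intro continuous_intros continuous_on_flux_quotient[OF cH bH])
      show "norm (exp (- l * max r 0) * flux_quotient d (H \<phi>) (max r 0)) \<le> 2 * B" for r
      proof -
        define x where "x = max r 0"
        have x: "x \<ge> 0" by (simp add: x_def)
        have "x \<le> exp (l * x)"
        proof -
          have "x \<le> l * x"
            using l x by (simp add: mult_le_cancel_right1)
          also have "\<dots> \<le> exp (l * x)"
            using exp_ge_add_one_self[of "l * x"] by linarith
          finally show ?thesis .
        qed
        then have "exp (- l * x) * x \<le> 1"
          by (simp add: exp_minus field_simps)
        then have "2 * B * (exp (- l * x) * x) \<le> 2 * B * 1"
          using B by (intro mult_left_mono) auto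
        moreover have "norm (exp (- l * x) * flux_quotient d (H \<phi>) x) \<le> exp (- l * x) * (2 * B * x)"
          unfolding norm_mult using flux_quotient_bound[OF cH x bH] by (intro mult_mono) auto
        ultimately show ?thesis
          by (simp add: x_def mult_ac)
      qed
    qed
    then show ?thesis
      by (simp add: T_def Bcontfun_inverse)
  qed
  have contraction: "dist (T \<phi>) (T \<psi>) \<le> 1/2 * dist \<phi> \<psi>" for \<phi> \<psi>
  proof (rule dist_bound)
    fix r :: real
    define x where "x = max r 0"
    have x: "x \<ge> 0" by (simp add: x_def)
    define \<delta> where "\<delta> = dist \<phi> \<psi>"
    have W_diff: "\<bar>W \<phi> s - W \<psi> s\<bar> \<le> \<delta> * exp (l * s)" for s
    proof -
      have "W \<phi> s - W \<psi> s = exp (l * s) * (apply_bcontfun \<phi> s - apply_bcontfun \<psi> s)"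
        by (simp add: W_def right_diff_distrib)
      then have "\<bar>W \<phi> s - W \<psi> s\<bar> = exp (l * s) * dist (apply_bcontfun \<phi> s) (apply_bcontfun \<psi> s)"
        by (simp add: abs_mult dist_real_def)
      then show ?thesis
        by (simp add: \<delta>_def mult.commute dist_bounded)
    qed
    have U_diff: "\<bar>U \<phi> s - U \<psi> s\<bar> \<le> \<delta> / l * exp (l * s)" if "s \<ge> 0" for s
      using flux_quotient_diff[OF cW cW that, of l \<delta> \<psi> \<phi> 0] W_diff[of _] l
      by (simp add: flux_quotient_def U_def \<delta>_def abs_minus_commute)
    have "\<bar>H \<phi> s - H \<psi> s\<bar> \<le> 2 * L * \<delta> * exp (l * s)" if s: "s \<ge> 0" for s
    proof -
      have "\<bar>H \<phi> s - H \<psi> s\<bar> \<le> \<bar>Phi (U \<phi> s) - Phi (U \<psi> s)\<bar> + \<bar>Psi (W \<phi> s) - Psi (W \<psi> s)\<bar>"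
        by (simp add: H_def)
      also have "\<dots> \<le> L * \<bar>U \<phi> s - U \<psi> s\<bar> + L * \<bar>W \<phi> s - W \<psi> s\<bar>"
        by (intro add_mono Phi Psi)
      also have "\<dots> \<le> L * (\<delta> / l * exp (l * s)) + L * (\<delta> * exp (l * s))"
        using L U_diff[OF s] W_diff[of s] by (intro add_mono mult_left_mono) auto
      also have "\<dots> \<le> L * (\<delta> / 1 * exp (l * s)) + L * (\<delta> * exp (l * s))"
        using L l by (intro add_mono mult_left_mono mult_right_mono divide_left_mono) (auto simp: \<delta>_def)
      finally show ?thesis
        by simp
    qed
    then have "\<bar>flux_quotient d (H \<phi>) x - flux_quotient d (H \<psi>) x\<bar> \<le> 2 * L * \<delta> / l * exp (l * x)"
      using l L by (intro flux_quotient_diff cH x) (auto simp: \<delta>_def)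
    then have "exp (- l * x) * \<bar>flux_quotient d (H \<phi>) x - flux_quotient d (H \<psi>) x\<bar>
        \<le> exp (- l * x) * (2 * L * \<delta> / l * exp (l * x))"
      by (intro mult_left_mono) auto
    also have "\<dots> = 2 * L / l * \<delta>"
      by (simp add: exp_minus)
    also have "\<dots> \<le> 1/2 * \<delta>"
      using L by (intro mult_right_mono) (auto simp: l_def \<delta>_def field_simps)
    finally show "dist (apply_bcontfun (T \<phi>) r) (apply_bcontfun (T \<psi>) r) \<le> 1/2 * dist \<phi> \<psi>"
      by (simp add: T dist_real_def abs_mult \<delta>_def flip: x_def right_diff_distrib)
  qed
  have "\<exists>!\<phi>. T \<phi> = \<phi>"
    by (rule banach_fix_type[of "1/2"]) (use contraction in auto)
  then obtain \<phi> where fixpoint: "T \<phi> = \<phi>"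
    by blast
  define w where "w r = flux_quotient d (H \<phi>) (max r 0)" for r
  define u where "u r = 1 - integral {0..r} w" for r
  have W_eq: "W \<phi> r = w r" if "r \<ge> 0" for r
  proof -
    have "W \<phi> r = exp (l * r) * apply_bcontfun (T \<phi>) r"
      by (simp add: W_def fixpoint)
    then show ?thesis
      using that by (simp add: T w_def exp_minus)
  qed
  have U_eq: "U \<phi> r = u r" if "r \<ge> 0" for r
    using W_eq integral_cong[of "{0..r}" "W \<phi>" w] by (simp add: U_def u_def)
  have cw: "continuous_on UNIV w"
    unfolding w_def by (rule continuous_on_flux_quotient[OF cH bH])
  have "radial_ode d u w (\<lambda>r. Phi (u r) + Psi (w r))"
  proof
    show "(u has_real_derivative - w r) (at r)" for r
      unfolding u_def
      using DERIV_diff[OF DERIV_const integral_of_vanishing_has_derivative[OF cw, of r], of 1]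
      by (simp add: w_def max_def)
    show "continuous_on UNIV w" by fact
    show "w 0 = 0"
      by (simp add: w_def)
    fix r :: real assume r: "r > 0"
    have "(flux_quotient d (H \<phi>) has_real_derivative H \<phi> r - real d / r * flux_quotient d (H \<phi>) r) (at r)"
      by (rule flux_quotient_deriv[OF cH r])
    moreover have "eventually (\<lambda>x. flux_quotient d (H \<phi>) x = w x) (nhds r)"
      using eventually_nhds_in_open[of "{0<..}" r] r
      by (auto elim!: eventually_mono simp: w_def)
    ultimately have "(w has_real_derivative H \<phi> r - real d / r * flux_quotient d (H \<phi>) r) (at r)"
      using DERIV_cong_ev by blast
    then show "(w has_real_derivative Phi (u r) + Psi (w r) - real d / r * w r) (at r)"
      using r W_eq[of r] U_eq[of r] by (simp add: H_def w_def)
  qed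
  moreover have "u 0 = 1"
    by (simp add: u_def)
  ultimately show ?thesis
    using that by blast
qed

subsection \<open>The supercritical case\<close>

lemma powr_lipschitz:
  fixes a c x y :: real
  assumes a: "a \<ge> 1" and x: "0 \<le> x" "x \<le> c" and y: "0 \<le> y" "y \<le> c"
  shows "\<bar>x powr a - y powr a\<bar> \<le> a * c powr (a - 1) * \<bar>x - y\<bar>"
proof -
  have *: "t powr a - s powr a \<le> a * c powr (a - 1) * (t - s)" if st: "0 \<le> s" "s \<le> t" "t \<le> c" for s t
  proof -
    have "a * c powr (a - 1) * s - s powr a \<le> a * c powr (a - 1) * t - t powr a"
    proof (rule DERIV_nonneg_imp_increasing_open[OF st(2)])
      fix z assume z: "s < z" "z < t"
      have "((\<lambda>z. a * c powr (a - 1) * z) has_real_derivative a * c powr (a - 1)) (at z)"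
        by (auto intro!: derivative_eq_intros)
      moreover have "((\<lambda>z. z powr a) has_real_derivative a * z powr (a - 1) * 1) (at z)"
        by (rule has_real_derivative_powr_const[OF DERIV_ident]) (use z st in auto)
      ultimately have "((\<lambda>z. a * c powr (a - 1) * z - z powr a) has_real_derivative
          a * c powr (a - 1) - a * z powr (a - 1) * 1) (at z)"
        by (rule DERIV_diff)
      moreover have "a * z powr (a - 1) * 1 \<le> a * c powr (a - 1)"
        using z st a by (auto intro!: mult_left_mono powr_mono2)
      ultimately show "\<exists>y. ((\<lambda>z. a * c powr (a - 1) * z - z powr a) has_real_derivative y) (at z) \<and> 0 \<le> y"
        by (meson diff_ge_0_iff_ge)
    next
      show "continuous_on {s..t} (\<lambda>z. a * c powr (a - 1) * z - z powr a)"
        using a st by (intro continuous_intros continuous_on_powr') auto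
    qed
    then show ?thesis
      by (simp add: right_diff_distrib)
  qed
  have mono: "s powr a \<le> t powr a" if "0 \<le> s" "s \<le> t" for s t
    using that a by (intro powr_mono2) auto
  show ?thesis
  proof (cases "x \<le> y")
    case True
    then show ?thesis
      using *[of x y] mono[of x y] x y by (simp add: abs_if)
  next
    case False
    then show ?thesis
      using *[of y x] mono[of y x] x y by (simp add: abs_if)
  qed
qed

text \<open>Clamping makes the power bounded and globally Lipschitz, as
  \<open>radial_ode_exists\<close> requires. The level \<open>c\<close> will be an a priori bound of
  the solution, so the clamp turns out to be inactive on it.\<close>

definition trunc_powr :: "real \<Rightarrow> real \<Rightarrow> real \<Rightarrow> real" where
  "trunc_powr a c x = (max 0 (min x c)) powr a"

lemma trunc_powr_lipschitz:
  assumes "a \<ge> 1" "c \<ge> 0"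
  shows "\<bar>trunc_powr a c x - trunc_powr a c y\<bar> \<le> a * c powr (a - 1) * \<bar>x - y\<bar>"
proof -
  have "\<bar>trunc_powr a c x - trunc_powr a c y\<bar> \<le> a * c powr (a - 1) * \<bar>max 0 (min x c) - max 0 (min y c)\<bar>"
    unfolding trunc_powr_def by (rule powr_lipschitz) (use assms in auto)
  also have "\<dots> \<le> a * c powr (a - 1) * \<bar>x - y\<bar>"
    using assms by (intro mult_left_mono) auto
  finally show ?thesis .
qed

lemma trunc_powr_bounds:
  assumes "a \<ge> 0" "c \<ge> 0"
  shows "0 \<le> trunc_powr a c x" "trunc_powr a c x \<le> c powr a"
  using assms by (auto simp: trunc_powr_def intro!: powr_mono2)

lemma trunc_powr_eq: "0 \<le> x \<Longrightarrow> x \<le> c \<Longrightarrow> trunc_powr a c x = x powr a"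
  by (simp add: trunc_powr_def)

lemma trunc_powr_le: "0 \<le> x \<Longrightarrow> a \<ge> 0 \<Longrightarrow> c \<ge> 0 \<Longrightarrow> trunc_powr a c x \<le> x powr a"
  by (auto simp: trunc_powr_def intro!: powr_mono2)

text \<open>
  Pohozaev's function with a multiplier \<open>\<sigma>\<close> strictly between \<open>N / (p + 1)\<close> and \<open>(N - 2) / 2\<close>,
  which exists because \<open>p\<close> is supercritical: both \<open>w\<^sup>2\<close> and \<open>u\<^sup>p\<^sup>+\<^sup>1\<close> then enter its derivative with a
  negative sign, and the slack absorbs the gradient term.
\<close>

definition pohozaev :: "nat \<Rightarrow> real \<Rightarrow> real \<Rightarrow> (real \<Rightarrow> real) \<Rightarrow> (real \<Rightarrow> real) \<Rightarrow> real \<Rightarrow> real" where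
  "pohozaev d p \<sigma> u w r =
     r ^ Suc d * ((w r)\<^sup>2 / 2 + u r powr (p + 1) / (p + 1)) - \<sigma> * (u r * (r ^ d * w r))"

context radial_ode
begin

text \<open>The equation \<open>(r^d w)' = r^d f\<close> is tested against
  \<open>r w - \<sigma> u\<close>. Keeping \<open>f\<close> general puts the whole gradient
  contribution, truncated or not, into the excess \<open>f - u^p\<close>.\<close>

lemma pohozaev_deriv:
  assumes p: "p > -1" and r: "r > 0" and ur: "u r > 0"
  shows "(pohozaev d p \<sigma> u w has_real_derivative
      r ^ d * ((\<sigma> - (real d - 1) / 2) * (w r)\<^sup>2 + ((real d + 1) / (p + 1) - \<sigma>) * u r powr (p + 1)
        + (f r - u r powr p) * (r * w r - \<sigma> * u r))) (at r)"
proof -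
  define w' where "w' = f r - real d / r * w r"
  define P where "P = u r powr p"
  have up: "u r powr (p + 1) = u r * P"
    using ur by (simp add: P_def powr_add)
  have dw: "(w has_real_derivative w') (at r)"
    using deriv_w[OF r] by (simp add: w'_def)
  have d1: "((\<lambda>r. (w r)\<^sup>2 / 2) has_real_derivative w r * w') (at r)"
    by (rule DERIV_cong[OF DERIV_cdivide[OF DERIV_power[OF dw]]]) simp
  have d2: "((\<lambda>r. u r powr (p + 1) / (p + 1)) has_real_derivative - P * w r) (at r)"
    by (rule DERIV_cong[OF DERIV_cdivide[OF has_real_derivative_powr_const[OF deriv_u ur]]])
      (use p in \<open>simp add: P_def\<close>)
  have d3: "((\<lambda>r. r ^ Suc d) has_real_derivative (real d + 1) * r ^ d) (at r)"
    using DERIV_pow[of "Suc d" r] by (simp add: add.commute)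
  have "(pohozaev d p \<sigma> u w has_real_derivative
      (real d + 1) * r ^ d * ((w r)\<^sup>2 / 2 + u r powr (p + 1) / (p + 1)) + (w r * w' + - P * w r) * r ^ Suc d
      - \<sigma> * (- w r * (r ^ d * w r) + (r ^ d * f r) * u r)) (at r)"
    unfolding pohozaev_def[abs_def]
    by (intro DERIV_diff DERIV_mult DERIV_add DERIV_cmult d1 d2 d3 deriv_u deriv_flux r)
  moreover have "(real d + 1) * r ^ d * ((w r)\<^sup>2 / 2 + u r powr (p + 1) / (p + 1)) + (w r * w' + - P * w r) * r ^ Suc d
      - \<sigma> * (- w r * (r ^ d * w r) + (r ^ d * f r) * u r)
    = r ^ d * ((\<sigma> - (real d - 1) / 2) * (w r)\<^sup>2 + ((real d + 1) / (p + 1) - \<sigma>) * u r powr (p + 1)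
        + (f r - P) * (r * w r - \<sigma> * u r))"
  proof -
    have rw': "r * w' = r * f r - real d * w r"
      using r by (simp add: w'_def right_diff_distrib)
    have "(w r * w' + - P * w r) * r ^ Suc d = r ^ d * (w r * (r * w') - r * P * w r)"
      by (simp add: algebra_simps)
    also have "\<dots> = r ^ d * (r * w r * f r - real d * (w r)\<^sup>2 - r * P * w r)"
      unfolding rw' by (simp add: algebra_simps power2_eq_square)
    finally have e: "(w r * w' + - P * w r) * r ^ Suc d = \<dots>" .
    define c where "c = (real d + 1) / (p + 1)"
    have c: "(real d + 1) * ((w r)\<^sup>2 / 2 + u r * P / (p + 1)) = (real d + 1) / 2 * (w r)\<^sup>2 + c * (u r * P)"
      by (simp add: c_def distrib_left)
    have "(real d + 1) * r ^ d * ((w r)\<^sup>2 / 2 + u r * P / (p + 1))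
        = r ^ d * ((real d + 1) / 2 * (w r)\<^sup>2 + c * (u r * P))"
      unfolding c[symmetric] by simp
    then show ?thesis
      unfolding e up c_def[symmetric] by (simp add: field_simps power2_eq_square)
  qed
  ultimately show ?thesis
    by (simp add: P_def)
qed

end

text \<open>At a first zero \<open>R\<close> of \<open>u\<close> the Pohozaev function would equal
  \<open>R^(d+1) w(R)^2 / 2 > 0\<close>, so keeping it nonpositive keeps \<open>u\<close> positive.
  The same sign bounds \<open>w\<close> and thereby removes the truncation.\<close>

lemma supercritical_profile_exists:
  assumes d: "d \<ge> 2" and p: "p > (real d + 3) / (real d - 1)" and q: "q \<ge> 2 * p / (p + 1)"
  obtains M3 where "M3 > 0" "\<And>M. 0 < M \<Longrightarrow> M < M3 \<Longrightarrow> \<exists>u w. radial_profile d u w p q M"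
proof -
  have "(real d + 3) / (real d - 1) > 1"
    using d by (simp add: field_simps)
  then have p1: "p > 1"
    using p by linarith
  have "2 * p / (p + 1) > 1"
    using p1 by (simp add: field_simps)
  then have q1: "q > 1"
    using q by linarith
  \<comment> \<open>The midpoint; \<open>c1\<close> and \<open>c2\<close> are its distances to the
    two ends and become the coefficients of \<open>- w^2\<close> and \<open>- u^(p+1)\<close> in the
    derivative.\<close>
  define \<sigma> where "\<sigma> = ((real d - 1) / 2 + (real d + 1) / (p + 1)) / 2"
  have lt: "(real d + 1) / (p + 1) < (real d - 1) / 2"
    using p p1 d by (simp add: field_simps)
  define c1 where "c1 = (real d - 1) / 2 - \<sigma>"
  define c2 where "c2 = \<sigma> - (real d + 1) / (p + 1)"
  have mid: "b - (b + a) / 2 > 0 \<and> (b + a) / 2 - a > 0" if "a < b" for a b :: real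
    using that by (auto simp: field_simps)
  have c1: "c1 > 0" and c2: "c2 > 0"
    using mid[OF lt] by (simp_all only: c1_def c2_def \<sigma>_def)
  have \<sigma>: "\<sigma> > 0"
    using d p1 by (simp add: \<sigma>_def add_pos_pos)
  obtain C where C: "C > 0"
    "\<And>r u w. r \<ge> 1/2 \<Longrightarrow> u > 0 \<Longrightarrow> w \<ge> 0 \<Longrightarrow> (p - 1) / (2 * (real d + 1)) * r\<^sup>2 \<le> u powr (1 - p) \<Longrightarrow>
       r * w \<le> 2 * \<sigma> * u \<Longrightarrow> r * w powr (q - 1) \<le> C"
    using weight_decay[OF p1 q, of "real d + 1" "2 * \<sigma>"] \<sigma> by (auto simp: add_pos_pos)
  \<comment> \<open>\<open>M \<le> 1\<close> allows \<open>early_bound\<close> with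
    \<open>K = 1\<close>; the other bound makes \<open>M r w^(q-1) \<le> c1\<close>, on
    \<open>[0, 1/2]\<close> through the 1 in the maximum and beyond through
    \<open>C\<close>.\<close>
  define M3 where "M3 = min 1 (c1 / max 1 C)"
  \<comment> \<open>The a priori bound on \<open>w\<close>, fixed before \<open>M\<close>:
    \<open>w \<le> 2r \<le> 1\<close> up to \<open>1/2\<close>, and beyond it
    \<open>r w \<le> 2 \<sigma> u \<le> 2 \<sigma>\<close> gives
    \<open>w \<le> 4 \<sigma>\<close>.\<close>
  define W where "W = max 1 (4 * \<sigma>)"
  have W: "W \<ge> 1"
    by (simp add: W_def)
  have "M3 > 0"
    using c1 by (auto simp: M3_def)
  moreover have "\<exists>u w. radial_profile d u w p q M" if M: "0 < M" "M < M3" for M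
  proof -
    have M1: "M \<le> 1"
      using M by (simp add: M3_def)
    have Mc: "M * x \<le> c1" if "x \<le> max 1 C" for x
    proof -
      have "M * x \<le> M * max 1 C"
        using that M by (intro mult_left_mono) auto
      also have "\<dots> \<le> c1 / max 1 C * max 1 C"
        using M by (intro mult_right_mono) (auto simp: M3_def)
      also have "\<dots> = c1"
        by simp
      finally show ?thesis .
    qed
    define Phi where "Phi = trunc_powr p 1"
    define Psi where "Psi x = M * trunc_powr q W x" for x
    define L where "L = max p (q * W powr (q - 1))"
    have L: "L \<ge> 0"
      using p1 by (simp add: L_def)
    obtain u w where ode: "radial_ode d u w (\<lambda>r. Phi (u r) + Psi (w r))" and u0: "u 0 = 1"
    proof (rule radial_ode_exists[OF L, of Phi "max 1 (W powr q)" Psi])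
      show "\<bar>Phi x - Phi y\<bar> \<le> L * \<bar>x - y\<bar>" for x y
      proof -
        have "\<bar>Phi x - Phi y\<bar> \<le> p * 1 powr (p - 1) * \<bar>x - y\<bar>"
          unfolding Phi_def by (rule trunc_powr_lipschitz) (use p1 in auto)
        also have "\<dots> \<le> L * \<bar>x - y\<bar>"
          by (intro mult_right_mono) (auto simp: L_def)
        finally show ?thesis .
      qed
      show "\<bar>Psi x - Psi y\<bar> \<le> L * \<bar>x - y\<bar>" for x y
      proof -
        have "\<bar>Psi x - Psi y\<bar> = M * \<bar>trunc_powr q W x - trunc_powr q W y\<bar>"
          using M by (simp add: Psi_def abs_mult flip: right_diff_distrib)
        also have "\<dots> \<le> 1 * (q * W powr (q - 1) * \<bar>x - y\<bar>)"
          using M M1 q1 W by (intro mult_mono trunc_powr_lipschitz) auto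
        also have "\<dots> \<le> L * \<bar>x - y\<bar>"
          unfolding mult_1 by (intro mult_right_mono) (auto simp: L_def)
        finally show ?thesis .
      qed
      show "\<bar>Phi x\<bar> \<le> max 1 (W powr q)" for x
        using trunc_powr_bounds[of p 1 x] p1 by (simp add: Phi_def)
      show "\<bar>Psi x\<bar> \<le> max 1 (W powr q)" for x
      proof -
        have "\<bar>Psi x\<bar> = M * trunc_powr q W x"
          using M trunc_powr_bounds(1)[of q W x] q1 W by (simp add: Psi_def abs_mult)
        also have "\<dots> \<le> 1 * W powr q"
          using M M1 trunc_powr_bounds[of q W x] q1 W by (intro mult_mono) auto
        finally show ?thesis
          by simp
      qed
    qed
    define f where "f r = Phi (u r) + Psi (w r)" for r
    interpret radial_ode d u w f
      using ode unfolding f_def[abs_def] .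
    have Phi0: "Phi x \<ge> 0" and Phi1: "Phi x \<le> 1" for x
      using trunc_powr_bounds[of p 1 x] p1 by (auto simp: Phi_def)
    have Psi0: "Psi x \<ge> 0" for x
      using trunc_powr_bounds(1)[of q W x] q1 W M by (simp add: Psi_def)
    have f0: "f r \<ge> 0" for r
      using Phi0 Psi0 by (simp add: f_def)
    have w0: "w r \<ge> 0" if "r \<ge> 0" for r
      using w_lower_bound[of r 0] f0 that w_zero by (cases "r = 0") auto
    have Psi_le: "Psi (w r) \<le> M * w r powr q" if "r \<ge> 0" for r
      unfolding Psi_def using trunc_powr_le[of "w r" q W] w0[OF that] q1 W M
      by (intro mult_left_mono) auto
    have u1: "u r \<le> 1" if "r \<ge> 0" for r
      using u_antimono[of 0 r] that f0 u0 by simp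
    have Phi_eq: "Phi (u r) = u r powr p" if "r \<ge> 0" "u r > 0" for r
      unfolding Phi_def using that u1 by (intro trunc_powr_eq) auto
    have early: "w r \<le> 2 * r" if "0 \<le> r" "r \<le> 1/2" for r
    proof (rule early_bound[where M = M and q = q and K = 1])
      show "f s \<le> 1 + M * w s powr q" if "0 < s" for s
        using Phi1[of "u s"] Psi_le[of s] that by (simp add: f_def)
    qed (use that M M1 q1 w0 in auto)
    let ?F = "pohozaev d p \<sigma> u w"
    have rw: "r * w r \<le> 2 * \<sigma> * u r" if r: "r > 0" and ur: "u r > 0" and F: "?F r \<le> 0" for r
    proof (cases "w r = 0")
      case True
      then show ?thesis
        using \<sigma> ur by simp
    next
      case False
      then have wr: "w r > 0"
        using w0[of r] r by simp
      have "r ^ Suc d * ((w r)\<^sup>2 / 2) \<le> r ^ Suc d * ((w r)\<^sup>2 / 2 + u r powr (p + 1) / (p + 1))"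
        using r p1 by (intro mult_left_mono) auto
      also have "\<dots> \<le> \<sigma> * (u r * (r ^ d * w r))"
        using F by (simp add: pohozaev_def)
      finally have "(r ^ d * w r) * (r * w r) \<le> (r ^ d * w r) * (2 * \<sigma> * u r)"
        by (simp add: power2_eq_square mult_ac)
      then show ?thesis
        using r wr mult_le_cancel_left_pos[of "r ^ d * w r"] by simp
    qed
    define F' where "F' r = r ^ d * ((\<sigma> - (real d - 1) / 2) * (w r)\<^sup>2 + ((real d + 1) / (p + 1) - \<sigma>) * u r powr (p + 1)
        + (f r - u r powr p) * (r * w r - \<sigma> * u r))" for r
    have dF: "(?F has_real_derivative F' r) (at r)" if "r > 0" "u r > 0" for r
      unfolding F'_def using pohozaev_deriv[of p r \<sigma>] p1 that by simp
    \<comment> \<open>Nonpositivity of the Pohozaev function is used at \<open>b\<close> alone: it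
      gives \<open>rw\<close>, then \<open>weight_decay\<close>, then
      \<open>Psi (w b) * (b * w b) \<le> c1 * (w b)^2\<close>. The term in \<open>c2\<close> makes
      the inequality strict, as \<open>barrier\<close> requires.\<close>
    have F'_neg: "F' b < 0"
      if b: "b > 0" and ub: "\<And>r. 0 \<le> r \<Longrightarrow> r \<le> b \<Longrightarrow> u r > 0" and or: "b \<le> 1/2 \<or> ?F b \<le> 0" for b
    proof -
      have uB: "u b > 0" and wB: "w b \<ge> 0"
        using ub b w0 by auto
      have "b * w b powr (q - 1) \<le> max 1 C"
      proof (cases "b \<le> 1/2")
        case True
        then have "w b powr (q - 1) \<le> 1 powr (q - 1)"
          using early[of b] b wB q1 by (intro powr_mono2) auto
        then have "b * w b powr (q - 1) \<le> 1 * 1"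
          using True b by (intro mult_mono) auto
        then show ?thesis
          by simp
      next
        case False
        then have "?F b \<le> 0"
          using or by simp
        moreover have "(p - 1) / (2 * (real d + 1)) * b\<^sup>2 \<le> u b powr (1 - p)"
        proof (rule decay[OF p1])
          show "u s powr p \<le> f s" if "0 < s" "s < b" for s
            using Phi_eq[of s] ub[of s] that Psi0[of "w s"] by (simp add: f_def)
        qed (use b ub in auto)
        ultimately have "b * w b powr (q - 1) \<le> C"
          using False b uB wB rw[of b] by (intro C(2)[of b "u b"]) auto
        then show ?thesis
          by simp
      qed
      then have Mb: "M * (b * w b powr (q - 1)) \<le> c1"
        by (rule Mc)
      have g: "f b - u b powr p = Psi (w b)"
        using Phi_eq[of b] b uB by (simp add: f_def)
      have "Psi (w b) * (b * w b - \<sigma> * u b) \<le> Psi (w b) * (b * w b)"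
        using Psi0 \<sigma> uB by (intro mult_left_mono) auto
      also have "\<dots> \<le> M * w b powr q * (b * w b)"
        using Psi_le[of b] b wB by (intro mult_right_mono) auto
      also have "\<dots> = M * (b * w b powr (q - 1)) * (w b)\<^sup>2"
        using wB by (cases "w b = 0") (simp_all add: powr_diff power2_eq_square)
      also have "\<dots> \<le> c1 * (w b)\<^sup>2"
        using Mb by (intro mult_right_mono) auto
      finally have "Psi (w b) * (b * w b - \<sigma> * u b) \<le> c1 * (w b)\<^sup>2" .
      moreover have "F' b = b ^ d * (- c1 * (w b)\<^sup>2 - c2 * u b powr (p + 1) + Psi (w b) * (b * w b - \<sigma> * u b))"
        by (simp add: F'_def g c1_def c2_def algebra_simps)
      moreover have "c2 * u b powr (p + 1) > 0"
        using c2 uB by simp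
      ultimately show ?thesis
        using b by (simp add: mult_less_0_iff)
    qed
    have cF: "continuous_on {0..b} ?F" if "\<And>r. 0 \<le> r \<Longrightarrow> r \<le> b \<Longrightarrow> u r \<ge> 0" for b
    proof -
      have "continuous_on {0..b} (\<lambda>r. u r powr (p + 1))"
        using that p1 by (intro continuous_on_powr' continuous_on_subset[OF cont_u] continuous_intros) auto
      moreover have "continuous_on {0..b} u" "continuous_on {0..b} w"
        using cont_u cont_w by (auto intro: continuous_on_subset)
      ultimately show ?thesis
        unfolding pohozaev_def[abs_def] using p1
        by (intro continuous_on_diff continuous_on_mult continuous_on_add continuous_on_divide
            continuous_on_power continuous_on_const continuous_on_id) auto
    qed
    have F_early: "?F b \<le> 0" if b: "0 \<le> b" "b \<le> 1/2" and ub: "\<And>r. 0 \<le> r \<Longrightarrow> r \<le> b \<Longrightarrow> u r > 0" for b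
    proof -
      have "?F b \<le> ?F 0"
      proof (rule DERIV_nonpos_imp_decreasing_open[OF b(1)])
        fix x assume x: "0 < x" "x < b"
        then have "F' x < 0"
          using b ub by (intro F'_neg) auto
        then show "\<exists>y. (?F has_real_derivative y) (at x) \<and> y \<le> 0"
          using dF[of x] ub[of x] x by (intro exI[of _ "F' x"]) auto
      qed (use ub cF in \<open>auto intro: less_imp_le\<close>)
      then show ?thesis
        by (simp add: pohozaev_def w_zero)
    qed
    have F_le: "?F b \<le> 0" if b: "0 < b" and ub: "\<And>r. 0 \<le> r \<Longrightarrow> r \<le> b \<Longrightarrow> u r > 0" for b
    proof (cases "b \<le> 1/2")
      case True
      then show ?thesis
        using F_early b ub by auto
    next
      case False
      have "0 \<le> - ?F b"
      proof (rule barrier[of "1/2" b "\<lambda>r. - ?F r" "\<lambda>r. - F' r" 0])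
        show "((\<lambda>r. - ?F r) has_real_derivative - F' r) (at r)" if "1/2 \<le> r" "r \<le> b" for r
          using dF[of r] ub[of r] that by (intro DERIV_minus) auto
        show "0 \<le> - ?F (1/2)"
          using F_early[of "1/2"] ub False by auto
        show "0 < - F' r" if "1/2 \<le> r" "r \<le> b" "- ?F r = 0" for r
          using F'_neg[of r] ub that by auto
      qed (use False in auto)
      then show ?thesis
        by simp
    qed
    have u_pos: "u r > 0" if r: "r \<ge> 0" for r
    proof (rule ccontr)
      assume "\<not> u r > 0"
      then obtain R where R: "0 < R" "- u R = 0" "\<And>x. 0 \<le> x \<Longrightarrow> x < R \<Longrightarrow> - u x < 0"
        using first_hit[of 0 r "\<lambda>r. - u r" 0] r u0 continuous_on_subset[OF cont_u, of "{0..r}"]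
        by (auto intro!: continuous_intros)
      have uR: "u R = 0" and ux: "\<And>x. 0 \<le> x \<Longrightarrow> x < R \<Longrightarrow> u x > 0"
        using R by auto
      have "w R > 0"
      proof (rule w_pos[OF R(1)])
        show "f s > 0" if "0 < s" "s < R" for s
          using ux[of s] that Phi_eq[of s] Psi0[of "w s"] by (simp add: f_def add_pos_nonneg)
      qed
      then have FR: "?F R > 0"
        using R(1) uR by (simp add: pohozaev_def)
      \<comment> \<open>\<open>F_le\<close> needs \<open>u > 0\<close> up to its endpoint and so
        fails at \<open>R\<close> itself; continuity supplies a point before \<open>R\<close> where
        the function is still positive.\<close>
      have "\<exists>x\<ge>R/2. x \<le> R \<and> ?F x = ?F R / 2"
      proof (rule IVT')
        show "?F (R/2) \<le> ?F R / 2"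
          using F_le[of "R/2"] ux R(1) FR by fastforce
        have "continuous_on {0..R} ?F"
          using ux uR by (intro cF) (metis less_eq_real_def)
        then show "continuous_on {R/2..R} ?F"
          by (rule continuous_on_subset) (use R(1) in auto)
      qed (use R FR in auto)
      then obtain x where x: "R/2 \<le> x" "x \<le> R" "?F x = ?F R / 2"
        by blast
      then have "x < R"
        using FR by (cases "x = R") auto
      then have "?F x \<le> 0"
        using x R(1) ux by (intro F_le) auto
      then show False
        using x FR by simp
    qed
    have w_le: "w r \<le> W" if r: "r \<ge> 0" for r
    proof (cases "r \<le> 1/2")
      case True
      then show ?thesis
        using early[OF r] by (simp add: W_def)
    next
      case False
      then have "r * w r \<le> 2 * \<sigma> * u r"
        using u_pos F_le by (intro rw) auto
      also have "\<dots> \<le> 2 * \<sigma> * 1"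
        using u1[OF r] \<sigma> by (intro mult_left_mono) auto
      finally have "r * w r \<le> 2 * \<sigma>"
        by simp
      moreover have "1/2 * w r \<le> r * w r"
        using False w0[OF r] by (intro mult_right_mono) auto
      ultimately show ?thesis
        by (simp add: W_def)
    qed
    have "radial_profile d u w p q M"
    proof
      fix r :: real assume r: "r > 0"
      have "Psi (w r) = M * w r powr q"
        unfolding Psi_def using w0[of r] w_le[of r] r by (simp add: trunc_powr_eq)
      then show "(w has_real_derivative u r powr p + M * w r powr q - real d / r * w r) (at r)"
        using deriv_w[OF r] Phi_eq[of r] u_pos[of r] r by (simp add: f_def)
    qed (use deriv_u cont_w w_zero p1 q1 M u_pos in auto)
    then show ?thesis
      by blast
  qed
  ultimately show ?thesis
    using that by blast
qed

subsection \<open>Radial functions in Euclidean space\<close>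

lemma has_real_derivative_along_line:
  fixes u :: "'a::euclidean_space \<Rightarrow> real"
  assumes "u differentiable (at (a + t *\<^sub>R b))"
  shows "((\<lambda>t. u (a + t *\<^sub>R b)) has_real_derivative partial_deriv b u (a + t *\<^sub>R b)) (at t)"
proof -
  let ?D = "frechet_derivative u (at (a + t *\<^sub>R b))"
  have D: "(u has_derivative ?D) (at (a + t *\<^sub>R b))"
    using assms by (simp add: frechet_derivative_works)
  have "((\<lambda>t. a + t *\<^sub>R b) has_derivative (\<lambda>h. h *\<^sub>R b)) (at t)"
    by (auto intro!: derivative_eq_intros)
  then have "((\<lambda>t. u (a + t *\<^sub>R b)) has_derivative (\<lambda>h. ?D (h *\<^sub>R b))) (at t)"
    by (rule has_derivative_compose) (rule D)
  moreover have "?D (h *\<^sub>R b) = partial_deriv b u (a + t *\<^sub>R b) * h" for h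
    using linear_scale[OF has_derivative_linear[OF D]] by (simp add: partial_deriv_def)
  ultimately show ?thesis
    by (simp add: has_field_derivative_def)
qed

lemma even_function_derivative_zero:
  fixes f :: "real \<Rightarrow> real"
  assumes D: "(f has_real_derivative D) (at 0)" and even: "\<And>h. f (- h) = f h"
  shows "D = 0"
proof -
  have "((\<lambda>h. f (- h)) has_real_derivative - D) (at 0)"
    using D DERIV_mirror[of f D 0] by simp
  then have "- D = D"
    using D DERIV_unique unfolding even by blast
  then show ?thesis
    by simp
qed

lemma norm_two_axes:
  fixes e b :: "'a::euclidean_space"
  assumes "e \<in> Basis" "b \<in> Basis" "b \<noteq> e"
  shows "norm (t *\<^sub>R e + h *\<^sub>R b) = sqrt (t\<^sup>2 + h\<^sup>2)"
  using assms
  by (simp add: norm_eq_sqrt_inner inner_add_left inner_add_right inner_Basis power2_eq_square)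

text \<open>Everything is computed on the ray through one basis vector \<open>e\<close>. There the
  transverse first derivatives vanish by symmetry, and each of the \<open>d\<close> transverse
  second derivatives equals \<open>v'(t) / t\<close>, which is the origin of the term
  \<open>d / r * w\<close>.\<close>

lemma radial_ground_state_imp_profile:
  fixes u :: "'a::euclidean_space \<Rightarrow> real"
  assumes gs: "radial_ground_state p q M u" and dim: "DIM('a) = Suc d"
    and p: "p > 1" and q: "q > 1" and M: "M > 0"
  obtains v w where "radial_profile d v w p q M" "v 0 = u 0"
proof -
  have C2: "C2_fun u" and u_pos: "\<And>x. u x > 0" and rad: "\<And>x y. norm x = norm y \<Longrightarrow> u x = u y"
    and eqn: "\<And>x. - laplacian u x = \<bar>u x\<bar> powr (p - 1) * u x + M * norm (gradient u x) powr q"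
    using gs unfolding radial_ground_state_def ground_state_def classical_solution_def radial_def by blast+
  have du: "u differentiable (at x)" and ddu: "b \<in> Basis \<Longrightarrow> partial_deriv b u differentiable (at x)" for x b
    using C2 by (auto simp: C2_fun_def C1_fun_def)
  obtain e :: 'a where e: "e \<in> Basis"
    using nonempty_Basis by blast
  define v where "v t = u (t *\<^sub>R e)" for t
  define g where "g t = partial_deriv e u (t *\<^sub>R e)" for t
  define g' where "g' t = partial_deriv e (partial_deriv e u) (t *\<^sub>R e)" for t
  have dv: "(v has_real_derivative g t) (at t)" for t
    using has_real_derivative_along_line[of u 0 t e] du by (simp add: v_def[abs_def] g_def)
  have dg: "(g has_real_derivative g' t) (at t)" for t
    using has_real_derivative_along_line[of "partial_deriv e u" 0 t e] ddu[OF e]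
    by (simp add: g_def[abs_def] g'_def)
  have u_eq: "u x = v (norm x)" for x
    unfolding v_def using e by (intro rad) simp
  have g0: "g 0 = 0"
    using dv by (rule even_function_derivative_zero) (auto simp: v_def intro: rad)
  have first: "partial_deriv b u (t *\<^sub>R e) = 0" if b: "b \<in> Basis" "b \<noteq> e" for t b
  proof (rule even_function_derivative_zero)
    show "((\<lambda>h. u (t *\<^sub>R e + h *\<^sub>R b)) has_real_derivative partial_deriv b u (t *\<^sub>R e)) (at 0)"
      using has_real_derivative_along_line[of u "t *\<^sub>R e" 0 b] du by simp
    show "u (t *\<^sub>R e + - h *\<^sub>R b) = u (t *\<^sub>R e + h *\<^sub>R b)" for h
      by (rule rad) (simp only: norm_two_axes[OF e b] power2_minus)
  qed
  have second: "partial_deriv b (partial_deriv b u) (t *\<^sub>R e) = g t / t"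
    if b: "b \<in> Basis" "b \<noteq> e" and t: "t > 0" for t b
  proof -
    define s where "s h = sqrt (t\<^sup>2 + h\<^sup>2)" for h
    have s: "s h > 0" and s_arg: "t\<^sup>2 + h\<^sup>2 > 0" for h
      using t by (auto simp: s_def add_pos_nonneg)
    have s0: "s 0 = t"
      using t by (simp add: s_def)
    \<comment> \<open>The first derivative is identified along the whole transverse line, as
      \<open>h\<close> times a continuous function of \<open>h\<close>. Its derivative at
      \<open>h = 0\<close> is then the value of that function, by Caratheodory's criterion.\<close>
    have P: "partial_deriv b u (t *\<^sub>R e + h *\<^sub>R b) = g (s h) / s h * h" for h
    proof -
      have "((\<lambda>h. t\<^sup>2 + h\<^sup>2) has_real_derivative 2 * h) (at h)"
        by (auto intro!: derivative_eq_intros)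
      then have "(s has_real_derivative inverse (s h) / 2 * (2 * h)) (at h)"
        unfolding s_def[abs_def]
        by (rule DERIV_chain2[where f = sqrt, rotated]) (rule DERIV_real_sqrt[OF s_arg])
      then have "((\<lambda>h. v (s h)) has_real_derivative g (s h) * (inverse (s h) / 2 * (2 * h))) (at h)"
        by (rule DERIV_chain2[OF dv])
      also have "(\<lambda>h. v (s h)) = (\<lambda>h. u (t *\<^sub>R e + h *\<^sub>R b))"
        by (rule ext) (simp only: s_def u_eq norm_two_axes[OF e b])
      finally have "((\<lambda>h. u (t *\<^sub>R e + h *\<^sub>R b)) has_real_derivative g (s h) * (inverse (s h) / 2 * (2 * h))) (at h)" .
      moreover have "((\<lambda>h. u (t *\<^sub>R e + h *\<^sub>R b)) has_real_derivative partial_deriv b u (t *\<^sub>R e + h *\<^sub>R b)) (at h)"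
        by (rule has_real_derivative_along_line) (rule du)
      ultimately have "g (s h) * (inverse (s h) / 2 * (2 * h)) = partial_deriv b u (t *\<^sub>R e + h *\<^sub>R b)"
        by (rule DERIV_unique)
      then show ?thesis
        by (simp add: field_simps)
    qed
    have "isCont g (s 0)"
      using dg DERIV_isCont by blast
    moreover have "isCont s 0"
      unfolding s_def by (intro continuous_intros)
    ultimately have "isCont (\<lambda>h. g (s h) / s h) 0"
      using s[of 0] by (intro continuous_intros isCont_o2[of 0 s g]) auto
    then have "((\<lambda>h. g (s h) / s h * h) has_real_derivative g (s 0) / s 0) (at 0)"
      unfolding CARAT_DERIV by (intro exI[of _ "\<lambda>h. g (s h) / s h"]) auto
    then have "((\<lambda>h. partial_deriv b u (t *\<^sub>R e + h *\<^sub>R b)) has_real_derivative g t / t) (at 0)"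
      by (simp only: P s0)
    moreover have "((\<lambda>h. partial_deriv b u (t *\<^sub>R e + h *\<^sub>R b)) has_real_derivative
        partial_deriv b (partial_deriv b u) (t *\<^sub>R e + 0 *\<^sub>R b)) (at 0)"
      by (rule has_real_derivative_along_line) (simp add: ddu b)
    ultimately have "g t / t = partial_deriv b (partial_deriv b u) (t *\<^sub>R e + 0 *\<^sub>R b)"
      by (rule DERIV_unique)
    then show ?thesis
      by simp
  qed
  define w where "w t = - g t" for t
  \<comment> \<open>The norm of the gradient is \<open>\<bar>w t\<bar>\<close>, and the sign of
    \<open>w\<close> is not known yet. Positivity of \<open>f\<close> yields \<open>w > 0\<close>,
    after which the absolute value disappears.\<close>
  define f where "f t = v t powr p + M * \<bar>w t\<bar> powr q" for t
  have v_pos: "v t > 0" for t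
    by (simp add: v_def u_pos)
  have f_pos: "f t > 0" for t
    using v_pos[of t] M by (simp add: f_def add_pos_nonneg)
  have ode: "- g' t = f t - real d / t * w t" if t: "t > 0" for t
  proof -
    have "laplacian u (t *\<^sub>R e) = g' t + (\<Sum>b\<in>Basis - {e}. partial_deriv b (partial_deriv b u) (t *\<^sub>R e))"
      unfolding laplacian_def g'_def by (rule sum.remove) (use e in auto)
    also have "(\<Sum>b\<in>Basis - {e}. partial_deriv b (partial_deriv b u) (t *\<^sub>R e)) = (\<Sum>b\<in>Basis - {e}. g t / t)"
      using second t by (intro sum.cong) auto
    also have "\<dots> = real d * (g t / t)"
      using e dim by (simp add: card_Diff_singleton)
    finally have lap: "laplacian u (t *\<^sub>R e) = g' t + real d * (g t / t)" .
    have "gradient u (t *\<^sub>R e) = g t *\<^sub>R e + (\<Sum>b\<in>Basis - {e}. partial_deriv b u (t *\<^sub>R e) *\<^sub>R b)"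
      unfolding gradient_def g_def by (rule sum.remove) (use e in auto)
    also have "(\<Sum>b\<in>Basis - {e}. partial_deriv b u (t *\<^sub>R e) *\<^sub>R b) = 0"
      using first by (intro sum.neutral) auto
    finally have "norm (gradient u (t *\<^sub>R e)) = \<bar>w t\<bar>"
      using e by (simp add: w_def)
    moreover have "\<bar>u (t *\<^sub>R e)\<bar> powr (p - 1) * u (t *\<^sub>R e) = v t powr p"
      using v_pos[of t] by (simp add: v_def powr_diff)
    ultimately have "- (g' t + real d * (g t / t)) = f t"
      using eqn[of "t *\<^sub>R e"] lap by (simp add: f_def)
    then show ?thesis
      by (simp add: w_def)
  qed
  have cg: "continuous_on UNIV g"
    using dg by (auto intro!: continuous_at_imp_continuous_on DERIV_isCont)
  interpret R: radial_ode d v w f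
  proof
    show "(v has_real_derivative - w t) (at t)" for t
      using dv by (simp add: w_def)
    show "continuous_on UNIV w"
      unfolding w_def by (intro continuous_intros cg)
    show "w 0 = 0"
      by (simp add: w_def g0)
    show "(w has_real_derivative f t - real d / t * w t) (at t)" if "t > 0" for t
      unfolding ode[OF that, symmetric] unfolding w_def[abs_def] by (intro DERIV_minus dg)
  qed
  have "radial_profile d v w p q M"
  proof
    show "(w has_real_derivative v t powr p + M * w t powr q - real d / t * w t) (at t)" if "t > 0" for t
      using R.deriv_w[OF that] R.w_pos[OF that] f_pos by (simp add: f_def)
  qed (use R.deriv_u R.cont_w R.w_zero p q M v_pos in auto)
  then show ?thesis
    using that by (simp add: v_def)
qed

section \<open>From profiles to ground states\<close>

text \<open>The product rule is out of reach, since \<open>c\<close> is only continuous; the linear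
  factor vanishing at 0 compensates. This gives the second derivatives at the origin.\<close>

lemma has_derivative_continuous_mult_linear:
  fixes c l :: "'a::euclidean_space \<Rightarrow> real"
  assumes c: "isCont c 0" and l: "bounded_linear l"
  shows "((\<lambda>x. c x * l x) has_derivative (\<lambda>h. c 0 * l h)) (at 0)"
  unfolding has_derivative_at
proof
  interpret l: bounded_linear l by fact
  show "bounded_linear (\<lambda>h. c 0 * l h)"
    by (rule bounded_linear_const_mult[OF l])
  obtain B where B: "\<And>x. norm (l x) \<le> norm x * B"
    using l.bounded by blast
  have "((\<lambda>h. \<bar>c h - c 0\<bar> * B) \<longlongrightarrow> \<bar>c 0 - c 0\<bar> * B) (at 0)"
    using c by (intro tendsto_intros) (simp add: isCont_def)
  then have lim: "((\<lambda>h. \<bar>c h - c 0\<bar> * B) \<longlongrightarrow> 0) (at 0)"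
    by simp
  show "((\<lambda>h. norm (c (0 + h) * l (0 + h) - c 0 * l 0 - c 0 * l h) / norm h) \<longlongrightarrow> 0) (at 0)"
  proof (rule Lim_null_comparison[OF always_eventually lim], rule allI)
    fix h
    have "norm (c (0 + h) * l (0 + h) - c 0 * l 0 - c 0 * l h) = \<bar>c h - c 0\<bar> * norm (l h)"
      by (simp add: l.zero abs_mult flip: left_diff_distrib)
    also have "\<dots> \<le> \<bar>c h - c 0\<bar> * (norm h * B)"
      by (intro mult_left_mono B) auto
    finally show "norm (norm (c (0 + h) * l (0 + h) - c 0 * l 0 - c 0 * l h) / norm h) \<le> \<bar>c h - c 0\<bar> * B"
      by (cases "h = 0") (auto simp: l.zero divide_simps mult_ac)
  qed
qed

text \<open>The chain rule fails because the norm is not differentiable at 0;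
  \<open>v'(0) = 0\<close> makes the increment \<open>o(norm h)\<close>.\<close>

lemma has_derivative_radial_at_0:
  fixes v :: "real \<Rightarrow> real"
  assumes "(v has_real_derivative 0) (at 0)"
  shows "((\<lambda>x::'a::euclidean_space. v (norm x)) has_derivative (\<lambda>h. 0)) (at 0)"
  unfolding has_derivative_at
proof
  have "((\<lambda>r. (v r - v 0) / r) \<longlongrightarrow> 0) (at 0)"
    using assms by (simp add: DERIV_def)
  then have lim: "((\<lambda>r. \<bar>(v r - v 0) / r\<bar>) \<longlongrightarrow> 0) (at 0)"
    by (rule tendsto_rabs_zero)
  have "filterlim norm (at 0) (at (0::'a))"
    unfolding filterlim_at by (auto intro!: tendsto_norm_zero simp: eventually_at_filter)
  then have "((\<lambda>h::'a. \<bar>(v (norm h) - v 0) / norm h\<bar>) \<longlongrightarrow> 0) (at 0)"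
    by (rule filterlim_compose[OF lim])
  then show "((\<lambda>h::'a. norm (v (norm (0 + h)) - v (norm (0::'a)) - 0) / norm h) \<longlongrightarrow> 0) (at 0)"
    by simp
qed simp

lemma partial_deriv_eq:
  assumes "(u has_derivative D) (at x)"
  shows "partial_deriv b u x = D b"
  using frechet_derivative_at[OF assms] by (simp add: partial_deriv_def)

context radial_profile
begin

definition forcing :: "real \<Rightarrow> real" where
  "forcing r = u r powr p + M * w r powr q"

text \<open>This is \<open>-u' / r\<close>, continued to 0 by its limit \<open>f(0) / N\<close>, so
  that the gradient is \<open>- slope (norm x)\<close> times \<open>x\<close> everywhere.\<close>

definition slope :: "real \<Rightarrow> real" where
  "slope r = (if r = 0 then forcing 0 / (real d + 1) else w r / r)"

lemma continuous_on_forcing: "continuous_on {0..} forcing"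
proof -
  have "continuous_on {0..} (\<lambda>r. w r powr q)"
    using w_nonneg q_gt_1 by (intro continuous_on_powr' continuous_on_subset[OF cont_w]) auto
  moreover have "continuous_on {0..} (\<lambda>r. u r powr p)"
    using u_pos by (intro continuous_intros continuous_on_subset[OF cont_u]) force+
  ultimately show ?thesis
    unfolding forcing_def[abs_def]
    by (intro continuous_on_add continuous_on_mult continuous_on_const)
qed

lemma slope_eventually:
  assumes "r \<noteq> 0"
  shows "eventually (\<lambda>x. w x / x = slope x) (nhds r)"
proof -
  have "eventually (\<lambda>x. x \<in> - {0}) (nhds r)"
    by (rule eventually_nhds_in_open) (use assms in auto)
  then show ?thesis
    by (rule eventually_mono) (simp add: slope_def)
qed

text \<open>L'Hopital's rule is applied to \<open>r^d w / r^(d+1)\<close>, whose quotient of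
  derivatives is \<open>forcing r / (d + 1)\<close>. Applied to \<open>w / r\<close> directly it
  would ask for the limit of \<open>w'\<close> at 0.\<close>

lemma continuous_on_slope: "continuous_on {0..} slope"
  unfolding continuous_on_eq_continuous_within
proof
  fix r :: real assume r: "r \<in> {0..}"
  show "continuous (at r within {0..}) slope"
  proof (cases "r = 0")
    case True
    have "(forcing \<longlongrightarrow> forcing 0) (at 0 within {0..})"
      using continuous_on_forcing by (simp add: continuous_on_def)
    then have "(forcing \<longlongrightarrow> forcing 0) (at_right 0)"
      by (rule tendsto_within_subset) auto
    then have "((\<lambda>r. forcing r / (real d + 1)) \<longlongrightarrow> forcing 0 / (real d + 1)) (at_right 0)"
      by (intro tendsto_intros) auto
    then have lim: "((\<lambda>r. (r ^ d * forcing r) / ((real d + 1) * r ^ d)) \<longlongrightarrow> forcing 0 / (real d + 1)) (at_right 0)"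
      by (rule Lim_transform_eventually)
        (auto simp: eventually_at_filter mult.commute[of "real d + 1"] intro!: always_eventually)
    have "((\<lambda>r. (r ^ d * w r) / r ^ Suc d) \<longlongrightarrow> forcing 0 / (real d + 1)) (at_right 0)"
    proof (rule lhopital_right_0[OF _ _ _ _ _ _ lim])
      have "isCont (\<lambda>r. r ^ d * w r) 0" "isCont (\<lambda>r::real. r ^ Suc d) 0"
        using cont_flux[of UNIV] by (auto simp: continuous_on_eq_continuous_at)
      then show "((\<lambda>r. r ^ d * w r) \<longlongrightarrow> 0) (at_right 0)" "((\<lambda>r::real. r ^ Suc d) \<longlongrightarrow> 0) (at_right 0)"
        by (auto simp: isCont_def w_zero intro: tendsto_within_subset)
      show "\<forall>\<^sub>F r in at_right 0. ((\<lambda>r. r ^ d * w r) has_real_derivative r ^ d * forcing r) (at r)"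
        using deriv_flux by (auto simp: eventually_at_filter forcing_def)
      show "\<forall>\<^sub>F r in at_right 0. ((\<lambda>r::real. r ^ Suc d) has_real_derivative (real d + 1) * r ^ d) (at r)"
      proof (rule always_eventually, rule allI)
        fix r :: real
        show "((\<lambda>r. r ^ Suc d) has_real_derivative (real d + 1) * r ^ d) (at r)"
          using DERIV_pow[of "Suc d" r] by (simp add: add.commute)
      qed
      have pos: "\<forall>\<^sub>F r in at_right 0. (0::real) < r"
        by (rule eventually_at_right_less)
      show "\<forall>\<^sub>F r in at_right 0. r ^ Suc d \<noteq> (0::real)" "\<forall>\<^sub>F r in at_right 0. (real d + 1) * r ^ d \<noteq> 0"
        by (rule eventually_mono[OF pos]; simp)+
    qed
    then have "(slope \<longlongrightarrow> forcing 0 / (real d + 1)) (at_right 0)"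
      by (rule Lim_transform_eventually) (auto simp: eventually_at_filter slope_def)
    moreover have "at (0::real) within {0..} = at_right 0"
    proof -
      have "{0..} - {0} = {0<..} - {0::real}"
        by auto
      then show ?thesis
        by (simp add: at_within_def)
    qed
    ultimately show ?thesis
      using True by (simp add: continuous_within slope_def)
  next
    case False
    then have "isCont w r"
      using cont_w by (simp add: continuous_on_eq_continuous_at)
    then have "isCont (\<lambda>r. w r / r) r"
      using False by (intro continuous_intros) auto
    then have "isCont slope r"
      using isCont_cong[OF slope_eventually[OF False]] by simp
    then show ?thesis
      by (rule continuous_at_imp_continuous_at_within)
  qed
qed

lemma slope_deriv:
  assumes r: "r > 0"
  shows "(slope has_real_derivative (forcing r - (real d + 1) * slope r) / r) (at r)"
proof -
  have "((\<lambda>r. w r / r) has_real_derivative ((forcing r - real d / r * w r) * r - w r * 1) / (r * r)) (at r)"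
    using DERIV_divide[OF deriv_w[OF r, folded forcing_def] DERIV_ident] r by simp
  moreover have "((forcing r - real d / r * w r) * r - w r * 1) / (r * r) = (forcing r - (real d + 1) * slope r) / r"
    using r by (simp add: slope_def field_simps)
  moreover have "eventually (\<lambda>x. w x / x = slope x) (nhds r)"
    using slope_eventually r by simp
  ultimately show ?thesis
    using DERIV_cong_ev by metis
qed

lemma slope_times: "slope r * r = w r"
  by (simp add: slope_def w_zero)

lemma continuous_at_radial:
  assumes "continuous_on {0..} h"
  shows "isCont (\<lambda>x::'a::euclidean_space. h (norm x)) x"
proof -
  have "continuous_on UNIV (\<lambda>x::'a. h (norm x))"
    by (rule continuous_on_compose2[OF assms]) (auto intro!: continuous_intros)
  then show ?thesis
    by (simp add: continuous_on_eq_continuous_at)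
qed

lemma radial_extension_derivative:
  "((\<lambda>x::'a::euclidean_space. u (norm x)) has_derivative (\<lambda>h. - slope (norm x) * (x \<bullet> h))) (at x)"
proof (cases "x = 0")
  case True
  then show ?thesis
    using has_derivative_radial_at_0[of u] deriv_u[of 0] by (simp add: w_zero)
next
  case False
  have "((\<lambda>x::'a. u (norm x)) has_derivative (\<lambda>h. - w (norm x) * (sgn x \<bullet> h))) (at x)"
    using has_derivative_compose[OF has_derivative_norm[OF False] deriv_u[unfolded has_field_derivative_def]]
    by (simp add: inner_commute)
  then show ?thesis
    using False by (simp add: slope_def sgn_div_norm divide_inverse mult_ac)
qed

text \<open>The coefficient \<open>forcing - (d + 1) * slope\<close> is \<open>r\<close> times the
  derivative of \<open>slope\<close>. Since \<open>sgn 0 = 0\<close>, the same formula is valid at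
  the origin, where only the second term survives.\<close>

lemma radial_extension_derivative2:
  fixes x b :: "'a::euclidean_space"
  shows "((\<lambda>x. - slope (norm x) * (x \<bullet> b)) has_derivative
    (\<lambda>h. - (forcing (norm x) - (real d + 1) * slope (norm x)) * (sgn x \<bullet> h) * (sgn x \<bullet> b)
         - slope (norm x) * (h \<bullet> b))) (at x)"
proof (cases "x = 0")
  case True
  have "isCont (\<lambda>x::'a. - slope (norm x)) 0"
    by (intro continuous_minus continuous_at_radial continuous_on_slope)
  from has_derivative_continuous_mult_linear[OF this bounded_linear_inner_left[of b]]
  show ?thesis
    using True by simp
next
  case False
  then have r: "norm x > 0" by simp
  have "((\<lambda>x. slope (norm x)) has_derivative
      (\<lambda>h. (forcing (norm x) - (real d + 1) * slope (norm x)) / norm x * (sgn x \<bullet> h))) (at x)"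
    using has_derivative_compose[OF has_derivative_norm[OF False]
        slope_deriv[OF r, unfolded has_field_derivative_def]] by (simp add: inner_commute)
  then have D: "((\<lambda>x. - slope (norm x) * (x \<bullet> b)) has_derivative
      (\<lambda>h. - slope (norm x) * (h \<bullet> b)
         + - ((forcing (norm x) - (real d + 1) * slope (norm x)) / norm x * (sgn x \<bullet> h)) * (x \<bullet> b))) (at x)"
    by (intro has_derivative_mult has_derivative_minus has_derivative_inner_left has_derivative_ident)
  have E: "- S * t + - (J / norm x * a) * (x \<bullet> b) = - J * a * (sgn x \<bullet> b) - S * t" for S t J a
    using False by (simp add: sgn_div_norm divide_inverse)
  show ?thesis
    using D by (simp only: E)
qed

lemma ground_state_of_profile:
  assumes dim: "DIM('a::euclidean_space) = Suc d"
  shows "radial_ground_state p q M (\<lambda>x::'a. u (norm x))"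
proof -
  let ?U = "\<lambda>x::'a. u (norm x)"
  let ?J = "\<lambda>r. forcing r - (real d + 1) * slope r"
  have P1: "partial_deriv b ?U = (\<lambda>x. - slope (norm x) * (x \<bullet> b))" for b
    by (rule ext) (simp add: partial_deriv_eq[OF radial_extension_derivative])
  have P2: "partial_deriv a (\<lambda>x. - slope (norm x) * (x \<bullet> b)) =
      (\<lambda>x::'a. - ?J (norm x) * (sgn x \<bullet> a) * (sgn x \<bullet> b) - slope (norm x) * (a \<bullet> b))" for a b
    by (rule ext) (rule partial_deriv_eq[OF radial_extension_derivative2])
  have contJ: "isCont (\<lambda>x::'a. ?J (norm x)) x" for x
    by (intro continuous_at_radial continuous_intros continuous_on_forcing continuous_on_slope)
  have contS: "isCont (\<lambda>x::'a. slope (norm x)) x" for x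
    by (intro continuous_at_radial continuous_on_slope)
  have J0: "?J 0 = 0"
    by (simp add: slope_def)
  \<comment> \<open>\<open>sgn\<close> is discontinuous at 0, but its components are at most 1 in
    absolute value and the factor \<open>?J (norm x)\<close> tends to 0.\<close>
  have cont2: "isCont (\<lambda>x::'a. - ?J (norm x) * (sgn x \<bullet> a) * (sgn x \<bullet> b) - slope (norm x) * (a \<bullet> b)) x"
    if ab: "a \<in> Basis" "b \<in> Basis" for a b x
  proof -
    have "isCont (\<lambda>x::'a. - ?J (norm x) * (sgn x \<bullet> a) * (sgn x \<bullet> b)) x"
    proof (cases "x = 0")
      case False
      then have "isCont (sgn :: 'a \<Rightarrow> 'a) x"
        by (intro isCont_sgn) auto
      then show ?thesis
        by (intro continuous_mult continuous_minus contJ continuous_inner continuous_const) auto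
    next
      case True
      have "((\<lambda>x::'a. ?J (norm x)) \<longlongrightarrow> 0) (at 0)"
        using contJ[of 0] J0 by (simp only: isCont_def norm_zero)
      then have lim: "((\<lambda>x::'a. \<bar>?J (norm x)\<bar>) \<longlongrightarrow> 0) (at 0)"
        by (rule tendsto_rabs_zero)
      have "((\<lambda>x::'a. - ?J (norm x) * (sgn x \<bullet> a) * (sgn x \<bullet> b)) \<longlongrightarrow> 0) (at 0)"
      proof (rule Lim_null_comparison[OF always_eventually lim], rule allI)
        fix x :: 'a
        have le: "\<bar>sgn x \<bullet> c\<bar> \<le> 1" if "c \<in> Basis" for c
          using Basis_le_norm[OF that, of "sgn x"] by (simp add: norm_sgn split: if_splits)
        have "norm (- j * (sgn x \<bullet> a) * (sgn x \<bullet> b)) \<le> \<bar>j\<bar>" for j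
        proof -
          have "\<bar>j\<bar> * (\<bar>sgn x \<bullet> a\<bar> * \<bar>sgn x \<bullet> b\<bar>) \<le> \<bar>j\<bar> * 1"
            using le ab by (intro mult_left_mono mult_le_one) auto
          then show ?thesis
            by (simp add: abs_mult mult.assoc)
        qed
        then show "norm (- ?J (norm x) * (sgn x \<bullet> a) * (sgn x \<bullet> b)) \<le> \<bar>?J (norm x)\<bar>" .
      qed
      then show ?thesis
        using True by (simp add: isCont_def)
    qed
    then show ?thesis
      by (rule continuous_diff) (intro continuous_mult contS continuous_const)
  qed
  have "C2_fun ?U"
    unfolding C2_fun_def
  proof (intro conjI allI ballI)
    show "?U differentiable (at x)" for x
      using radial_extension_derivative by (rule differentiableI)
    fix b :: 'a assume b: "b \<in> Basis"
    show "C1_fun (partial_deriv b ?U)"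
      unfolding C1_fun_def P1 P2
    proof (intro conjI allI ballI)
      show "(\<lambda>x. - slope (norm x) * (x \<bullet> b)) differentiable (at x)" for x
        using radial_extension_derivative2 by (rule differentiableI)
      show "continuous_on UNIV (\<lambda>x. - ?J (norm x) * (sgn x \<bullet> a) * (sgn x \<bullet> b) - slope (norm x) * (a \<bullet> b))"
        if "a \<in> Basis" for a
        using cont2[OF that b] by (intro continuous_at_imp_continuous_on) auto
    qed
  qed
  moreover have "- laplacian ?U x = \<bar>?U x\<bar> powr (p - 1) * ?U x + M * norm (gradient ?U x) powr q" for x
  proof -
    have "gradient ?U x = - slope (norm x) *\<^sub>R (\<Sum>b\<in>Basis. (x \<bullet> b) *\<^sub>R b)"
      unfolding gradient_def P1 by (simp add: scaleR_sum_right)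
    then have "norm (gradient ?U x) = \<bar>slope (norm x) * norm x\<bar>"
      by (simp add: euclidean_representation abs_mult)
    then have grad: "norm (gradient ?U x) = w (norm x)"
      using w_nonneg[of "norm x"] by (simp add: slope_times)
    have "laplacian ?U x = (\<Sum>b\<in>Basis. - ?J (norm x) * ((sgn x \<bullet> b) * (sgn x \<bullet> b)) - slope (norm x) * 1)"
      unfolding laplacian_def P1 P2 by (intro sum.cong) (auto simp: inner_Basis mult.assoc)
    also have "\<dots> = - ?J (norm x) * (sgn x \<bullet> sgn x) - slope (norm x) * (real d + 1)"
      unfolding sum_subtractf sum_distrib_left[symmetric] euclidean_inner[of "sgn x" "sgn x", symmetric]
      by (simp add: dim algebra_simps)
    \<comment> \<open>Away from 0, \<open>sgn x\<close> is a unit vector and the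
      \<open>slope\<close> terms cancel. At 0 the first term is absent and
      \<open>(d + 1) * slope 0 = forcing 0\<close> by definition.\<close>
    also have "\<dots> = - forcing (norm x)"
    proof (cases "x = 0")
      case True
      then show ?thesis
        by (simp add: slope_def)
    next
      case False
      then have "sgn x \<bullet> sgn x = 1"
        by (simp add: dot_square_norm norm_sgn)
      then show ?thesis
        by (simp add: algebra_simps)
    qed
    finally have "- laplacian ?U x = u (norm x) powr p + M * w (norm x) powr q"
      by (simp add: forcing_def)
    moreover have "\<bar>?U x\<bar> powr (p - 1) * ?U x = ?U x powr p"
      using u_pos[of "norm x"] by (simp add: powr_diff)
    ultimately show ?thesis
      by (simp add: grad)
  qed
  ultimately show ?thesis
    using u_pos
    by (auto simp: radial_ground_state_def ground_state_def classical_solution_def radial_def)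
qed

end

section \<open>Transfer of the results on profiles to ground states, with
  \<open>N = d + 1\<close>\<close>

theorem theoremF:
  fixes p q :: real
  shows
   "(p > 1 \<and> q > 2 * p / (p + 1) \<longrightarrow>
       (\<exists>M1>0. \<forall>M>M1. \<not> (\<exists>u :: real ^ 'n \<Rightarrow> real. radial_ground_state p q M u \<and> u 0 = 1)))
  \<and> (p > 1 \<and> (CARD('n) \<ge> 3 \<longrightarrow> p < (real CARD('n) + 2) / (real CARD('n) - 2)) \<longrightarrow>
       (1 < q \<and> q \<le> p \<longrightarrow>
          (\<forall>M>0. \<not> (\<exists>u :: real ^ 'n \<Rightarrow> real. radial_ground_state p q M u)))
     \<and> (q > p \<longrightarrow>
          (\<exists>M2>0. \<forall>M. 0 < M \<and> M < M2 \<longrightarrow>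
             \<not> (\<exists>u :: real ^ 'n \<Rightarrow> real. radial_ground_state p q M u \<and> u 0 = 1))))
  \<and> (CARD('n) \<ge> 3 \<and> p > (real CARD('n) + 2) / (real CARD('n) - 2) \<and> q \<ge> 2 * p / (p + 1) \<longrightarrow>
       (\<exists>M3>0. \<forall>M. 0 < M \<and> M < M3 \<longrightarrow>
          (\<exists>u :: real ^ 'n \<Rightarrow> real. radial_ground_state p q M u)))"
proof -
  define d where "d = CARD('n) - 1"
  have N: "CARD('n) = Suc d"
    by (simp add: d_def)
  then have dim: "DIM(real ^ 'n) = Suc d"
    by simp
  have profile: "\<exists>v w. radial_profile d v w p q M \<and> v 0 = u 0"
    if "radial_ground_state p q M u" "p > 1" "q > 1" "M > 0" for M and u :: "real ^ 'n \<Rightarrow> real"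
    using radial_ground_state_imp_profile[OF that(1) dim that(2-4)] by blast
  have subcrit: "(real d - 1) * (p - 1) < 4"
    if "p > 1" "CARD('n) \<ge> 3 \<longrightarrow> p < (real CARD('n) + 2) / (real CARD('n) - 2)"
  proof (cases "CARD('n) \<ge> 3")
    case True
    then show ?thesis
      using that by (simp add: N field_simps)
  next
    case False
    then have "(real d - 1) * (p - 1) \<le> 0"
      using that(1) N by (intro mult_nonpos_nonneg) auto
    then show ?thesis
      by simp
  qed
  have part1: "\<exists>M1>0. \<forall>M>M1. \<not> (\<exists>u :: real ^ 'n \<Rightarrow> real. radial_ground_state p q M u \<and> u 0 = 1)"
    if p: "p > 1" and q: "q > 2 * p / (p + 1)"
  proof -
    have "2 * p / (p + 1) > 1"
      using p by (simp add: field_simps)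
    then have q1: "q > 1"
      using q by linarith
    obtain M1 where M1: "M1 > 0" "\<And>M u w. M > M1 \<Longrightarrow> u 0 = 1 \<Longrightarrow> \<not> radial_profile d u w p q M"
      using no_profile_for_large_M[OF q1] by blast
    then show ?thesis
      using profile p q1 by (metis order_less_trans)
  qed
  have part2a: "\<not> (\<exists>u :: real ^ 'n \<Rightarrow> real. radial_ground_state p q M u)"
    if "p > 1" "CARD('n) \<ge> 3 \<longrightarrow> p < (real CARD('n) + 2) / (real CARD('n) - 2)" "1 < q" "q \<le> p" "M > 0" for M
    using profile no_profile_subcritical[OF that(4) subcrit[OF that(1,2)]] that by blast
  have part2b: "\<exists>M2>0. \<forall>M. 0 < M \<and> M < M2 \<longrightarrow>
      \<not> (\<exists>u :: real ^ 'n \<Rightarrow> real. radial_ground_state p q M u \<and> u 0 = 1)"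
    if p: "p > 1" and N': "CARD('n) \<ge> 3 \<longrightarrow> p < (real CARD('n) + 2) / (real CARD('n) - 2)" and q: "q > p"
  proof -
    obtain M2 where "M2 > 0" "\<And>M u w. M < M2 \<Longrightarrow> u 0 = 1 \<Longrightarrow> \<not> radial_profile d u w p q M"
      using no_profile_for_small_M[OF p q subcrit[OF p N']] by blast
    then show ?thesis
      using profile p q by (metis order_less_trans)
  qed
  have part3: "\<exists>M3>0. \<forall>M. 0 < M \<and> M < M3 \<longrightarrow> (\<exists>u :: real ^ 'n \<Rightarrow> real. radial_ground_state p q M u)"
    if N3: "CARD('n) \<ge> 3" "p > (real CARD('n) + 2) / (real CARD('n) - 2)" and q: "q \<ge> 2 * p / (p + 1)"
  proof -
    have "d \<ge> 2" "p > (real d + 3) / (real d - 1)"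
      using N3 by (auto simp: N add.commute)
    then obtain M3 where "M3 > 0" "\<And>M. 0 < M \<Longrightarrow> M < M3 \<Longrightarrow> \<exists>u w. radial_profile d u w p q M"
      using supercritical_profile_exists[OF _ _ q] by blast
    then show ?thesis
      using radial_profile.ground_state_of_profile[OF _ dim] by metis
  qed
  show ?thesis
    using part1 part2a part2b part3 by blast
qed

end
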